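(* Let $G_1=(V,E_1)$ and $G_3=(V,E_3)$ be planar graphs and $T_2=(V,E_2)$ be a tree, all with shared vertex set $V$. Then $\langle G_1,T_2,G_3\rangle$ admits a QuaSEFE in which the drawings of $G_1$ and $T_2$ are planar.
   Context: Drawings are topological: vertices are distinct points of the plane and edges are curves joining their endpoints. A drawing is quasiplanar if no three of its edges pairwise cross. Given graphs $G_1=(V,E_1),\ldots,G_k=(V,E_k)$ on a shared vertex set $V$, the tuple $\langle G_1,\ldots,G_k\rangle$ admits a QuaSEFE if there are quasiplanar drawings $\Gamma_1,\ldots,\Gamma_k$ of $G_1,\ldots,G_k$ such that each vertex of $V$ has the same position in every $\Gamma_i$ and each edge shared by $G_i$ and $G_j$ is drawn as the same curve in $\Gamma_i$ and $\Gamma_j$. *)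

theory Defs
  imports "HOL-Analysis.Analysis"
begin

definition simple_graph :: "'v set \<Rightarrow> 'v set set \<Rightarrow> bool" where
  "simple_graph V E \<longleftrightarrow> finite V \<and> (\<forall>e\<in>E. e \<subseteq> V \<and> card e = 2)"

definition connected_graph :: "'v set \<Rightarrow> 'v set set \<Rightarrow> bool" where
  "connected_graph V E \<longleftrightarrow>
     V \<noteq> {} \<and> (\<forall>u\<in>V. \<forall>v\<in>V. (u, v) \<in> {(x, y). {x, y} \<in> E}\<^sup>*)"

definition graph_cycle :: "'v set set \<Rightarrow> 'v list \<Rightarrow> bool" where
  "graph_cycle E p \<longleftrightarrow> 3 \<le> length p \<and> distinct p \<and>
     (\<forall>i<length p. {p ! i, p ! (Suc i mod length p)} \<in> E)"

definition tree_graph :: "'v set \<Rightarrow> 'v set set \<Rightarrow> bool" where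
  "tree_graph V E \<longleftrightarrow>
     simple_graph V E \<and> connected_graph V E \<and> (\<nexists>p. graph_cycle E p)"

text \<open>
  The curve of an edge is recorded as a point set, so that ``drawn as the same curve'' does not
  depend on a parametrization or an orientation of the edge.
\<close>

record 'v drawing =
  vpos :: "'v \<Rightarrow> complex"
  ecurve :: "'v set \<Rightarrow> complex set"

text \<open>
  The usual conventions for topological drawings: edges are simple curves and
  avoid all vertices other than their endpoints.
\<close>

definition is_drawing :: "'v set \<Rightarrow> 'v set set \<Rightarrow> 'v drawing \<Rightarrow> bool" where
  "is_drawing V E \<Gamma> \<longleftrightarrow>
     inj_on (vpos \<Gamma>) V \<and>
     (\<forall>e\<in>E. \<exists>g. arc g \<and> path_image g = ecurve \<Gamma> e \<and>
        {pathstart g, pathfinish g} = vpos \<Gamma> ` e) \<and>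
     (\<forall>e\<in>E. \<forall>v\<in>V. vpos \<Gamma> v \<in> ecurve \<Gamma> e \<longrightarrow> v \<in> e)"

definition edge_interior :: "'v drawing \<Rightarrow> 'v set \<Rightarrow> complex set" where
  "edge_interior \<Gamma> e = ecurve \<Gamma> e - vpos \<Gamma> ` e"

text \<open>
  Any common interior point counts as a crossing; in particular touchings and overlaps do.
\<close>

definition edges_cross :: "'v drawing \<Rightarrow> 'v set \<Rightarrow> 'v set \<Rightarrow> bool" where
  "edges_cross \<Gamma> e f \<longleftrightarrow> e \<noteq> f \<and> edge_interior \<Gamma> e \<inter> edge_interior \<Gamma> f \<noteq> {}"

definition planar_drawing :: "'v set \<Rightarrow> 'v set set \<Rightarrow> 'v drawing \<Rightarrow> bool" where
  "planar_drawing V E \<Gamma> \<longleftrightarrow>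
     is_drawing V E \<Gamma> \<and> (\<forall>e\<in>E. \<forall>f\<in>E. \<not> edges_cross \<Gamma> e f)"

definition quasiplanar_drawing :: "'v set \<Rightarrow> 'v set set \<Rightarrow> 'v drawing \<Rightarrow> bool" where
  "quasiplanar_drawing V E \<Gamma> \<longleftrightarrow>
     is_drawing V E \<Gamma> \<and>
     (\<forall>e\<in>E. \<forall>f\<in>E. \<forall>g\<in>E. \<not> (edges_cross \<Gamma> e f \<and> edges_cross \<Gamma> f g \<and> edges_cross \<Gamma> e g))"

definition planar_graph :: "'v set \<Rightarrow> 'v set set \<Rightarrow> bool" where
  "planar_graph V E \<longleftrightarrow> simple_graph V E \<and> (\<exists>\<Gamma>. planar_drawing V E \<Gamma>)"

definition is_QuaSEFE :: "'v set \<Rightarrow> 'v set set list \<Rightarrow> 'v drawing list \<Rightarrow> bool" where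
  "is_QuaSEFE V Es \<Gamma>s \<longleftrightarrow>
     length \<Gamma>s = length Es \<and>
     (\<forall>i<length Es. quasiplanar_drawing V (Es ! i) (\<Gamma>s ! i)) \<and>
     (\<forall>i<length Es. \<forall>j<length Es.
        (\<forall>v\<in>V. vpos (\<Gamma>s ! i) v = vpos (\<Gamma>s ! j) v) \<and>
        (\<forall>e\<in>Es ! i \<inter> Es ! j. ecurve (\<Gamma>s ! i) e = ecurve (\<Gamma>s ! j) e))"

end

theory Submission
  imports Defs "HOL-Complex_Analysis.Complex_Analysis"
begin

text \<open>
  Split \<open>E1 \<union> E2 \<union> E3\<close> into the classes \<open>E1\<close>, \<open>E3 - E1\<close> and the single remaining edges of \<open>E2\<close>.
  Each class is planar, and it suffices to draw every class without crossings, all of them with the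
  same vertex positions, so that the edges of the tree do not cross each other: then \<open>E3\<close> is covered
  by two crossing-free classes, and among three of its edges two lie in the same class.

  The tree is placed step by step. A step takes an unplaced component \<open>K\<close> of the tree edges of one
  class that touches the placed part in a single vertex \<open>w\<close>. The drawing of that class is
  transformed by injective continuous maps of the plane that fix what is already placed and carry
  \<open>K\<close> into a thin sector at \<open>w\<close> that is free of placed curves; then the vertices of \<open>K\<close> are moved to
  their new positions in all other drawings, in the complement of the placed curves, which is
  connected because these curves form a forest.

  The map into the sector arises as follows. Since \<open>K\<close> does not separate the plane, it has a simply
  connected neighbourhood, in which the Riemann mapping theorem allows to shrink \<open>K\<close> into a small
  disc about \<open>w\<close>. Redrawing the edges radially near \<open>w\<close> makes \<open>K\<close> avoid a sector at \<open>w\<close>. Inversion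
  at \<open>w\<close> turns the exterior of the disc into the unit disc \<open>Q\<close> and \<open>K\<close> into a set reaching to infinity
  outside of a sector. Now shrink \<open>Q\<close>, slide it past \<open>K\<close> far into that sector, translate everything
  back and unshrink \<open>Q\<close>: this fixes \<open>Q\<close> pointwise, and \<open>K\<close> ends up on one side of \<open>Q\<close>.
\<close>

subsection \<open>Injective continuous maps of the plane\<close>

text \<open>Injectivity and continuity carry arcs to arcs and preserve every incidence and every
  disjointness, so planar drawings can be transported; the image may be a proper part of the
  plane.\<close>

definition plane_embedding :: "(complex \<Rightarrow> complex) \<Rightarrow> bool" where
  "plane_embedding h \<longleftrightarrow> continuous_on UNIV h \<and> inj h"

lemma plane_embedding_id: "plane_embedding (\<lambda>z. z)"
  by (simp add: plane_embedding_def)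

lemma plane_embedding_comp:
  "plane_embedding f \<Longrightarrow> plane_embedding g \<Longrightarrow> plane_embedding (\<lambda>z. f (g z))"
  unfolding plane_embedding_def
  using continuous_on_compose2[of UNIV f UNIV g] inj_compose[of f g] by (simp add: comp_def)

lemma plane_embedding_add: "plane_embedding (\<lambda>z. z + a)"
  unfolding plane_embedding_def by (auto simp: inj_on_def intro!: continuous_intros)

lemma plane_embedding_mult: "a \<noteq> 0 \<Longrightarrow> plane_embedding (\<lambda>z. a * z)"
  unfolding plane_embedding_def by (auto simp: inj_on_def intro!: continuous_intros)

text \<open>With Lipschitz constant \<open>norm d * L\<close> below 1, the displacements of two
  distinct points differ by less than the points do, so they cannot make the images
  coincide.\<close>

lemma plane_embedding_perturb:
  fixes \<phi> :: "complex \<Rightarrow> real"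
  assumes lip: "\<And>x y. \<bar>\<phi> x - \<phi> y\<bar> \<le> L * norm (x - y)" and small: "norm d * L < 1"
  shows "plane_embedding (\<lambda>z. z + \<phi> z *\<^sub>R d)"
proof -
  have "L \<ge> 0" using lip[of 1 0] by simp
  have c: "continuous_on UNIV \<phi>"
  proof (rule continuous_onI)
    fix x :: complex and e :: real assume "e > 0"
    have "dist (\<phi> x') (\<phi> x) \<le> e" if "dist x' x < e / (L + 1)" for x'
    proof -
      have "dist (\<phi> x') (\<phi> x) \<le> L * dist x' x" using lip[of x' x] by (simp add: dist_norm)
      also have "\<dots> \<le> (L + 1) * dist x' x" by (simp add: mult_right_mono)
      also have "\<dots> \<le> e" using that \<open>L \<ge> 0\<close> by (simp add: field_simps)
      finally show ?thesis .
    qed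
    then show "\<exists>r>0. \<forall>x'\<in>UNIV. dist x' x < r \<longrightarrow> dist (\<phi> x') (\<phi> x) \<le> e"
      using \<open>e > 0\<close> \<open>L \<ge> 0\<close> by (intro exI[of _ "e / (L + 1)"]) auto
  qed
  have "x = y" if "x + \<phi> x *\<^sub>R d = y + \<phi> y *\<^sub>R d" for x y
  proof -
    have "x - y = (\<phi> y - \<phi> x) *\<^sub>R d" using that by (simp add: algebra_simps)
    then have "norm (x - y) = \<bar>\<phi> y - \<phi> x\<bar> * norm d" by simp
    also have "\<dots> \<le> L * norm (x - y) * norm d"
      using lip[of x y] by (intro mult_right_mono) (auto simp: abs_minus_commute)
    finally have "norm (x - y) * (1 - norm d * L) \<le> 0" by (simp add: algebra_simps)
    then have "norm (x - y) \<le> 0" using small by (auto simp: mult_le_0_iff)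
    then show ?thesis by simp
  qed
  then have "inj (\<lambda>z. z + \<phi> z *\<^sub>R d)" by (rule injI)
  moreover have "continuous_on UNIV (\<lambda>z. z + \<phi> z *\<^sub>R d)" by (intro continuous_intros c)
  ultimately show ?thesis unfolding plane_embedding_def by blast
qed

section \<open>Cutoff displacements and local translations\<close>

definition bump :: "real \<Rightarrow> real \<Rightarrow> real" where
  "bump r s = max 0 (min 1 (2 - s / r))"

lemma bump_lip: assumes "r > 0" shows "\<bar>bump r s - bump r t\<bar> \<le> \<bar>s - t\<bar> / r"
proof -
  have "\<bar>bump r s - bump r t\<bar> \<le> \<bar>s / r - t / r\<bar>" unfolding bump_def by linarith
  also have "\<dots> = \<bar>s - t\<bar> / r" using assms by (simp add: diff_divide_distrib[symmetric])
  finally show ?thesis .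
qed

text \<open>The displacement is damped by \<open>bump\<close>, whose slope \<open>1 / r\<close>
  gives the Lipschitz constant \<open>norm (y - x) / r\<close>, which is below 1.\<close>

lemma small_move:
  assumes "r > 0" and "norm (y - x) < r"
  shows "\<exists>h. plane_embedding h \<and> (\<forall>z. z \<notin> ball x (2 * r) \<longrightarrow> h z = z)
          \<and> (\<forall>z\<in>ball x r. h z = z + (y - x))"
proof (intro exI conjI)
  let ?h = "\<lambda>z. z + bump r (norm (z - x)) *\<^sub>R (y - x)"
  show "plane_embedding ?h"
  proof (rule plane_embedding_perturb)
    fix a b
    have "\<bar>bump r (norm (a - x)) - bump r (norm (b - x))\<bar> \<le> \<bar>norm (a - x) - norm (b - x)\<bar> / r"
      by (rule bump_lip) fact
    also have "\<dots> \<le> norm (a - b) / r"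
      using norm_triangle_ineq3[of "a - x" "b - x"] assms by (intro divide_right_mono) auto
    finally show "\<bar>bump r (norm (a - x)) - bump r (norm (b - x))\<bar> \<le> (1 / r) * norm (a - b)" by simp
    show "norm (y - x) * (1 / r) < 1" using assms by simp
  qed
  show "\<forall>z. z \<notin> ball x (2 * r) \<longrightarrow> ?h z = z"
  proof (intro allI impI)
    fix z assume "z \<notin> ball x (2 * r)"
    then have "norm (z - x) / r \<ge> 2" using assms by (simp add: dist_norm norm_minus_commute field_simps)
    then show "?h z = z" by (simp add: bump_def)
  qed
  show "\<forall>z\<in>ball x r. ?h z = z + (y - x)"
  proof
    fix z assume "z \<in> ball x r"
    then have "norm (z - x) / r \<le> 1" using assms by (simp add: dist_norm norm_minus_commute field_simps)
    then show "?h z = z + (y - x)" by (simp add: bump_def)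
  qed
qed

text \<open>Connected induction on the target composes small moves inside \<open>S\<close>. The map
  has to be an exact translation near \<open>a\<close> so that a shrunken disc travels rigidly and
  can be restored afterwards; the bounded support controls the map at infinity.\<close>

lemma local_translation:
  fixes S :: "complex set"
  assumes "open S" "connected S" "a \<in> S" "b \<in> S"
  shows "\<exists>h. plane_embedding h \<and> (\<forall>z. z \<notin> S \<longrightarrow> h z = z) \<and> bounded {z. h z \<noteq> z}
          \<and> (\<exists>e>0. \<forall>z\<in>ball a e. h z = z + (b - a))"
    (is "?P b")
proof (rule connected_induction_simple[of S a b ?P])
  show "connected S" "a \<in> S" "b \<in> S" by fact+
  show "?P a"
    by (rule exI[of _ "\<lambda>z. z"]) (auto simp: plane_embedding_id intro: exI[of _ 1])
next
  fix c assume "c \<in> S"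
  then obtain r where r: "r > 0" "ball c r \<subseteq> S" using \<open>open S\<close> open_contains_ball by blast
  \<comment> \<open>With radius \<open>r / 8\<close> any two points of \<open>?T\<close> are closer
    than \<open>r / 4\<close>, and the disc of radius \<open>r / 2\<close> about either of them
    stays inside \<open>S\<close>.\<close>
  let ?T = "ball c (r / 8)"
  have "?P y" if "x \<in> ?T" "y \<in> ?T" "?P x" for x y
  proof -
    obtain h e where h: "plane_embedding h" "\<And>z. z \<notin> S \<Longrightarrow> h z = z" "bounded {z. h z \<noteq> z}" "e > 0"
      "\<And>z. z \<in> ball a e \<Longrightarrow> h z = z + (x - a)" using \<open>?P x\<close> by metis
    have "dist y x < r / 4"
      by (rule dist_triangle_half_l[of _ c]) (use that(1,2) in \<open>auto simp: dist_commute\<close>)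
    then have "norm (y - x) < r / 4" by (simp add: dist_norm)
    then obtain k where k: "plane_embedding k" "\<And>z. z \<notin> ball x (2 * (r / 4)) \<Longrightarrow> k z = z"
      "\<And>z. z \<in> ball x (r / 4) \<Longrightarrow> k z = z + (y - x)"
      using small_move[of "r / 4" y x] r(1) by auto
    have sub: "ball x (2 * (r / 4)) \<subseteq> S"
    proof
      fix z assume "z \<in> ball x (2 * (r / 4))"
      then have "dist c z < r" using \<open>x \<in> ?T\<close> dist_triangle[of c z x] r(1) by simp
      then show "z \<in> S" using r(2) by auto
    qed
    show ?thesis
    proof (intro exI conjI allI impI ballI)
      show "plane_embedding (\<lambda>z. k (h z))" by (rule plane_embedding_comp) fact+
      show "k (h z) = z" if "z \<notin> S" for z using that sub k(2) h(2) by force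
      have "{z. k (h z) \<noteq> z} \<subseteq> {z. h z \<noteq> z} \<union> ball x (2 * (r / 4))" using k(2) by force
      then show "bounded {z. k (h z) \<noteq> z}" by (rule bounded_subset[rotated]) (simp add: h(3))
      \<comment> \<open>\<open>h\<close> carries the disc of this radius about \<open>a\<close> into
        the disc about \<open>x\<close> on which \<open>k\<close> is a translation.\<close>
      show "min e (r / 4) > 0" using h(4) r(1) by simp
      fix z assume z: "z \<in> ball a (min e (r / 4))"
      then have "h z = z + (x - a)" using h(5) by simp
      moreover have "x - h z = a - z" using calculation by simp
      then have "h z \<in> ball x (r / 4)" using z by (simp add: dist_norm)
      ultimately show "k (h z) = z + (y - a)" using k(3) by simp
    qed
  qed
  then have step: "\<forall>x\<in>?T. \<forall>y\<in>?T. ?P x \<longrightarrow> ?P y" by (intro ballI impI)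
  have op: "openin (top_of_set S) ?T"
    using r \<open>open S\<close> by (auto simp: openin_open_eq)
  have cT: "c \<in> ?T" using r(1) by simp
  show "\<exists>T. openin (top_of_set S) T \<and> c \<in> T \<and> (\<forall>x\<in>T. \<forall>y\<in>T. ?P x \<longrightarrow> ?P y)"
    by (rule exI[of _ ?T], intro conjI) (rule op cT step)+
qed

text \<open>Radial and fixing everything outside the disc of radius \<open>c\<close>; \<open>squash b a c\<close> is the inverse.\<close>

definition squash :: "real \<Rightarrow> real \<Rightarrow> real \<Rightarrow> complex \<Rightarrow> complex" where
  "squash a b c z = (if norm z \<le> a then (b / a) *\<^sub>R z
     else if norm z \<le> c then ((b + (c - b) / (c - a) * (norm z - a)) / norm z) *\<^sub>R z else z)"

lemma squash_continuous:
  assumes "0 < a" "a < c" "0 < b" "b < c"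
  shows "continuous_on UNIV (squash a b c)"
proof -
  let ?g = "\<lambda>z. if norm z \<le> c then ((b + (c - b) / (c - a) * (norm z - a)) / norm z) *\<^sub>R z else z"
  have "continuous_on {z. a \<le> norm z} ?g"
    by (rule continuous_on_cases_le) (use assms in \<open>auto intro!: continuous_intros\<close>)
  then show ?thesis unfolding squash_def[abs_def]
    by (intro continuous_on_cases_le) (use assms in \<open>auto intro!: continuous_intros\<close>)
qed

lemma squash_small: "norm z \<le> a \<Longrightarrow> squash a b c z = (b / a) *\<^sub>R z"
  by (simp add: squash_def)

lemma squash_large: "0 < a \<Longrightarrow> a < c \<Longrightarrow> norm z \<ge> c \<Longrightarrow> squash a b c z = z"
  by (auto simp: squash_def)

text \<open>On each ray \<open>squash a b c\<close> is increasing and piecewise linear in the radius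
  and takes 0, \<open>a\<close>, \<open>c\<close> to 0, \<open>b\<close>, \<open>c\<close>;
  exchanging \<open>a\<close> and \<open>b\<close> inverts each piece.\<close>

lemma squash_inverse:
  assumes "0 < a" "a < c" "0 < b" "b < c"
  shows "squash b a c (squash a b c z) = z"
proof -
  consider "norm z \<le> a" | "a < norm z" "norm z \<le> c" | "c < norm z" by linarith
  then show ?thesis
  proof cases
    case 1
    then have "norm ((b / a) *\<^sub>R z) \<le> b" using assms by (simp add: field_simps)
    then show ?thesis using 1 assms by (simp add: squash_def)
  next
    case 2
    let ?t = "b + (c - b) / (c - a) * (norm z - a)"
    have t: "b < ?t" using 2 assms by simp
    have "(c - b) / (c - a) * (norm z - a) \<le> (c - b) / (c - a) * (c - a)"
      using 2 assms by (intro mult_left_mono) auto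
    then have t2: "?t \<le> c" using assms by simp
    have z0: "norm z > 0" using 2 assms by linarith
    have n: "norm ((?t / norm z) *\<^sub>R z) = ?t" using z0 assms(3) t by (simp only: norm_scaleR) simp
    have "(c - a) / (c - b) * ((c - b) / (c - a) * (norm z - a)) = norm z - a" using assms by simp
    then have e: "a + (c - a) / (c - b) * (?t - b) = norm z" by simp
    have q: "squash a b c z = (?t / norm z) *\<^sub>R z" using 2 by (simp add: squash_def)
    have "squash b a c (squash a b c z) = ((a + (c - a) / (c - b) * (?t - b)) / ?t) *\<^sub>R ((?t / norm z) *\<^sub>R z)"
      unfolding q squash_def[of b] n using t t2 by simp
    also have "\<dots> = z" unfolding e scaleR_scaleR using z0 t assms(3)
      by (simp only: times_divide_times_eq) (simp add: mult.commute less_imp_neq[symmetric])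
    finally show ?thesis .
  next
    case 3 then show ?thesis using assms by (simp add: squash_def)
  qed
qed

lemma plane_embedding_squash:
  assumes "0 < a" "a < c" "0 < b" "b < c"
  shows "plane_embedding (squash a b c)"
  unfolding plane_embedding_def
  by (intro conjI squash_continuous inj_on_inverseI[where g = "squash b a c"] squash_inverse assms)

subsection \<open>Moving a set into a thin sector\<close>

text \<open>The condition at infinity is what makes the conjugate of \<open>h\<close> by
  \<open>inverse\<close> continuous at the origin.\<close>

definition proper_embedding :: "(complex \<Rightarrow> complex) \<Rightarrow> bool" where
  "proper_embedding h \<longleftrightarrow> plane_embedding h \<and> filterlim h at_infinity at_infinity"

lemma proper_embedding_comp:
  "proper_embedding f \<Longrightarrow> proper_embedding g \<Longrightarrow> proper_embedding (\<lambda>z. f (g z))"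
  unfolding proper_embedding_def by (blast intro: plane_embedding_comp filterlim_compose)

lemma proper_embeddingI:
  assumes "plane_embedding h" "k > 0" "\<And>z. norm (h z) \<ge> k * norm z - C"
  shows "proper_embedding h"
  unfolding proper_embedding_def
proof
  show "plane_embedding h" by fact
  show "filterlim h at_infinity at_infinity"
    unfolding filterlim_at_infinity[OF order_refl]
  proof (intro allI impI)
    fix r :: real assume "0 < r"
    have "r \<le> norm (h z)" if "norm z \<ge> (r + C) / k" for z
    proof -
      have "r + C \<le> k * norm z" using that \<open>k > 0\<close> by (simp add: field_simps)
      then show ?thesis using assms(3)[of z] by linarith
    qed
    then show "\<forall>\<^sub>F x in at_infinity. r \<le> norm (h x)"
      unfolding eventually_at_infinity by blast
  qed
qed

lemma proper_embedding_local:
  assumes "plane_embedding h" "bounded {z. h z \<noteq> z}"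
  shows "proper_embedding h"
proof -
  obtain B where B0: "B > 0" and B: "\<And>z. h z \<noteq> z \<Longrightarrow> norm z \<le> B"
    using assms(2) unfolding bounded_pos by blast
  have "1 * norm z - B \<le> norm (h z)" for z
  proof (cases "h z = z")
    case True then show ?thesis using B0 by simp
  next
    case False
    then show ?thesis using B[of z] norm_ge_zero[of "h z"] by linarith
  qed
  then show ?thesis using proper_embeddingI[of h 1 B] assms(1) by simp
qed

lemma proper_embedding_add: "proper_embedding (\<lambda>z. z + a)"
proof (rule proper_embeddingI[of _ 1 "norm a"])
  show "1 * norm z - norm a \<le> norm (z + a)" for z using norm_triangle_ineq4[of "z + a" a] by simp
qed (simp_all add: plane_embedding_add)

lemma proper_embedding_squash:
  assumes "0 < a" "a < c" "0 < b" "b < c"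
  shows "proper_embedding (squash a b c)"
proof (rule proper_embedding_local)
  have "{z. squash a b c z \<noteq> z} \<subseteq> ball 0 c"
    using squash_large[OF assms(1,2)] by force
  then show "bounded {z. squash a b c z \<noteq> z}" using bounded_ball bounded_subset by blast
qed (rule plane_embedding_squash[OF assms])

text \<open>Maps the complement of the sector \<open>Re z \<ge> c * norm z\<close> into a left half-plane, up to a bounded error.\<close>

definition pull_left :: "real \<Rightarrow> complex \<Rightarrow> complex" where
  "pull_left c z = z + max 0 (norm z - 1) *\<^sub>R complex_of_real (- c)"

lemma proper_embedding_pull_left:
  assumes "0 < c" "c < 1"
  shows "proper_embedding (pull_left c)"
proof (rule proper_embeddingI[of _ "1 - c" 0])
  show "plane_embedding (pull_left c)" unfolding pull_left_def[abs_def]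
  proof (rule plane_embedding_perturb[where L = 1])
    fix x y :: complex
    show "\<bar>max 0 (norm x - 1) - max 0 (norm y - 1)\<bar> \<le> 1 * norm (x - y)"
      using norm_triangle_ineq3[of x y] by linarith
  qed (use assms in auto)
  show "1 - c > 0" using assms by simp
  fix z :: complex
  have "norm (max 0 (norm z - 1) *\<^sub>R complex_of_real (- c)) \<le> c * norm z"
    using assms by (auto simp: abs_if max_def mult_left_mono algebra_simps)
  moreover have "norm z - norm (max 0 (norm z - 1) *\<^sub>R complex_of_real (- c)) \<le> norm (pull_left c z)"
    unfolding pull_left_def by (rule norm_diff_ineq)
  ultimately show "(1 - c) * norm z - 0 \<le> norm (pull_left c z)"
    unfolding left_diff_distrib by linarith
qed

text \<open>Left of the line where the real part is -1, the distance to that line is multiplied by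
  \<open>1 + m\<close> at unchanged height. Points well to the left thus get close to the negative
  real axis in direction, while the unit disc stays fixed.\<close>

definition stretch_left :: "real \<Rightarrow> complex \<Rightarrow> complex" where
  "stretch_left m z = z - complex_of_real (m * max 0 (- Re z - 1))"

lemma proper_embedding_stretch_left:
  assumes "0 < m"
  shows "proper_embedding (stretch_left m)"
proof (rule proper_embeddingI[of _ 1 0])
  have "continuous_on UNIV (stretch_left m)" unfolding stretch_left_def[abs_def]
    by (intro continuous_intros)
  moreover have "inj (stretch_left m)"
  proof (rule injI)
    fix x y assume eq: "stretch_left m x = stretch_left m y"
    have "Im x = Im y" using arg_cong[OF eq, of Im] by (simp add: stretch_left_def)
    have r: "Re x - m * max 0 (- Re x - 1) = Re y - m * max 0 (- Re y - 1)"
      using arg_cong[OF eq, of Re] by (simp add: stretch_left_def)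
    have "Re x = Re y"
    proof (cases "Re x \<le> Re y")
      case True
      then have "m * max 0 (- Re y - 1) \<le> m * max 0 (- Re x - 1)"
        using assms by (intro mult_left_mono) auto
      then show ?thesis using True r by linarith
    next
      case False
      then have "m * max 0 (- Re x - 1) \<le> m * max 0 (- Re y - 1)"
        using assms by (intro mult_left_mono) auto
      then show ?thesis using False r by linarith
    qed
    then show "x = y" using \<open>Im x = Im y\<close> by (simp add: complex_eq_iff)
  qed
  ultimately show "plane_embedding (stretch_left m)" by (simp add: plane_embedding_def)
  fix z :: complex
  have "\<bar>Re z\<bar> \<le> \<bar>Re (stretch_left m z)\<bar>"
  proof (cases "Re z < - 1")
    case True
    have "m * max 0 (- Re z - 1) \<ge> 0" using assms by simp
    then show ?thesis using True unfolding stretch_left_def by simp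
  qed (auto simp: stretch_left_def)
  then have "norm z \<le> norm (stretch_left m z)"
    unfolding cmod_def by (intro real_sqrt_le_mono add_mono)
      (auto simp: stretch_left_def abs_le_square_iff)
  then show "1 * norm z - 0 \<le> norm (stretch_left m z)" by simp
qed simp

text \<open>Seen from \<open>K\<close>, the unit disc slides to the right: it is shrunk without
  touching \<open>K\<close>, carried through the complement of \<open>K\<close> to a far point
  \<open>R\<close> of the sector, brought back by a translation of the whole plane, and enlarged
  again. Altogether the disc is fixed while \<open>K\<close> is translated by
  \<open>- R\<close>.\<close>

lemma push_far_left:
  fixes K :: "complex set"
  assumes "closed K" and outside: "\<And>z. z \<in> K \<Longrightarrow> norm z > 1" and "connected (- K)"
    and c: "0 < c" "c < 1" and sector: "\<And>z. z \<in> K \<Longrightarrow> norm z \<ge> M \<Longrightarrow> Re z < c * norm z"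
    and "N > 1"
  shows "\<exists>H. proper_embedding H \<and> (\<forall>z\<in>cball 0 1. H z = z)
           \<and> (\<forall>z\<in>K. Re (H z) < c * norm (H z) \<and> norm (H z) \<ge> N)"
proof -
  have "cball 0 1 \<inter> K = {}" using outside by force
  \<comment> \<open>The gap \<open>b\<close> leaves room for radial maps: \<open>squash\<close> acts
    only inside radius \<open>1 + b\<close>, which \<open>K\<close> does not enter.\<close>
  then obtain b where b: "b > 0" "\<And>x y. x \<in> cball 0 1 \<Longrightarrow> y \<in> K \<Longrightarrow> b \<le> dist x y"
    using separate_compact_closed[of "cball 0 1" K] \<open>closed K\<close> by auto
  define d where "d = 1 + b"
  have "d > 1" using b(1) by (simp add: d_def)
  \<comment> \<open>The radial projection \<open>sgn z\<close> lies in the unit disc and turns the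
    gap between the two sets into a bound on \<open>norm z\<close>.\<close>
  have dK: "norm z \<ge> d" if "z \<in> K" for z
  proof -
    have "z \<noteq> 0" using outside[OF that] by auto
    then have "sgn z - z = (1 / norm z - 1) *\<^sub>R z"
      by (simp add: sgn_div_norm scaleR_left_diff_distrib divide_inverse)
    then have "dist (sgn z) z = \<bar>1 / norm z - 1\<bar> * norm z" by (simp only: dist_norm norm_scaleR)
    also have "1 / norm z \<le> 1" using less_imp_le[OF outside[OF that]] divide_le_eq_1_pos[of "norm z" 1] \<open>z \<noteq> 0\<close> by simp
    then have "\<bar>1 / norm z - 1\<bar> * norm z = (1 - 1 / norm z) * norm z" by simp
    also have "\<dots> = norm z - 1" using \<open>z \<noteq> 0\<close> by (simp add: left_diff_distrib)
    finally have "dist (sgn z) z = norm z - 1" .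
    moreover have "b \<le> dist (sgn z) z" using that \<open>z \<noteq> 0\<close> by (intro b(2)) (auto simp: norm_sgn)
    ultimately show ?thesis by (simp add: d_def)
  qed
  define N' where "N' = max N d"
  \<comment> \<open>\<open>R\<close> is so large that the disc of radius \<open>N'\<close> about it
    lies inside the sector and beyond radius \<open>M\<close>; hence it misses
    \<open>K\<close>.\<close>
  define R where "R = \<bar>M\<bar> + N' + N' * (1 + c) / (1 - c) + 1"
  have N': "N' > 1" "N' \<ge> N" "N' \<ge> d" using \<open>N > 1\<close> by (auto simp: N'_def)
  have "N' * (1 + c) / (1 - c) \<ge> 0" using N'(1) c by simp
  then have R: "R > N' + M" "R > 0" "R > M" using N'(1) unfolding R_def by linarith+
  have "R \<ge> N' * (1 + c) / (1 - c)" using N'(1) unfolding R_def by linarith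
  then have R2: "R - N' \<ge> c * (R + N')" using c by (simp add: field_simps)
  have RK: "norm (z - complex_of_real R) > N'" if "z \<in> K" for z
  proof (rule ccontr)
    assume "\<not> ?thesis"
    then have n: "norm (z - complex_of_real R) \<le> N'" by simp
    have "\<bar>Re (z - complex_of_real R)\<bar> \<le> N'" using abs_Re_le_cmod n order_trans by blast
    then have r: "R - N' \<le> Re z" by simp
    have "norm z \<ge> Re z" by (rule complex_Re_le_cmod)
    then have "Re z < c * norm z" using r R(1) by (intro sector that) linarith
    also have "norm z \<le> R + N'"
      using norm_triangle_ineq[of "z - complex_of_real R" "complex_of_real R"] n R(2) by simp
    then have "c * norm z \<le> c * (R + N')" using c by simp
    also have "\<dots> \<le> Re z" using R2 r by linarith
    finally show False by simp
  qed
  have "open (- K)" using \<open>closed K\<close> by (simp add: open_closed)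
  moreover have "0 \<in> - K" using outside[of 0] by auto
  moreover have "complex_of_real R \<in> - K" using RK[of "complex_of_real R"] N'(1) by auto
  ultimately obtain h e where h: "plane_embedding h" "\<And>z. z \<in> K \<Longrightarrow> h z = z" "bounded {z. h z \<noteq> z}"
    "e > 0" "\<And>z. z \<in> ball 0 e \<Longrightarrow> h z = z + complex_of_real R"
    using local_translation[of "- K" 0 "complex_of_real R"] \<open>connected (- K)\<close> by auto
  define \<epsilon> where "\<epsilon> = min (e / 2) (1 / 2)"
  have \<epsilon>: "0 < \<epsilon>" "\<epsilon> < 1" "\<epsilon> < e" using h(4) by (auto simp: \<epsilon>_def)
  define H where "H z = squash \<epsilon> 1 d (h (squash 1 \<epsilon> d z) + (- complex_of_real R))" for z
  have HQ: "H z = z" if "norm z \<le> 1" for z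
  proof -
    have "norm (\<epsilon> *\<^sub>R z) \<le> \<epsilon>" using that \<epsilon> by (simp add: mult_left_le)
    moreover from this have "h (\<epsilon> *\<^sub>R z) = \<epsilon> *\<^sub>R z + complex_of_real R"
      using \<epsilon>(3) by (intro h(5)) (simp add: dist_norm del: norm_scaleR)
    ultimately show ?thesis using that \<epsilon> by (simp add: H_def squash_small del: norm_scaleR)
  qed
  have HK: "H z = z - complex_of_real R" if "z \<in> K" for z
    using dK[OF that] h(2)[OF that] RK[OF that] N'(3) \<epsilon> \<open>d > 1\<close> by (simp add: H_def squash_large)
  have "proper_embedding H" unfolding H_def[abs_def]
    using \<epsilon> \<open>d > 1\<close>
    by (intro proper_embedding_comp[OF proper_embedding_squash proper_embedding_comp[OF proper_embedding_add
          proper_embedding_comp[OF proper_embedding_local[OF h(1,3)] proper_embedding_squash]]]) auto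
  \<comment> \<open>A translation to the left cannot enter the convex sector from outside. Points of
    norm below \<open>M\<close>, about which the sector hypothesis is silent, have real part below
    \<open>R\<close> and end up in the left half-plane.\<close>
  moreover have "Re (z - complex_of_real R) < c * norm (z - complex_of_real R)" if "z \<in> K" for z
  proof (cases "Re z \<le> R")
    case True
    have "c * norm (z - complex_of_real R) > 0"
      by (intro mult_pos_pos) (use RK[OF that] N'(1) c in linarith)+
    then show ?thesis using True by simp
  next
    case False
    have "norm z \<ge> M" using False R(3) complex_Re_le_cmod[of z] by linarith
    then have s: "Re z < c * norm z" by (intro sector that)
    have "(Re z)\<^sup>2 < (c * norm z)\<^sup>2" using s False R(2) by (intro power_strict_mono) auto
    then have 1: "(1 - c\<^sup>2) * (Re z)\<^sup>2 < c\<^sup>2 * (Im z)\<^sup>2"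
      by (simp add: power_mult_distrib cmod_power2 algebra_simps)
    have "(1 - c\<^sup>2) * (Re z - R)\<^sup>2 \<le> (1 - c\<^sup>2) * (Re z)\<^sup>2"
      using False R(2) c by (intro mult_left_mono power_mono) (auto simp: power_le_one_iff)
    then have "(Re z - R)\<^sup>2 < (c * norm (z - complex_of_real R))\<^sup>2"
      using 1 by (simp add: power_mult_distrib cmod_power2 algebra_simps)
    then have "Re z - R < c * norm (z - complex_of_real R)"
      using c by (intro power_less_imp_less_base[of "Re z - R" 2]) auto
    then show ?thesis by simp
  qed
  ultimately show ?thesis
    using HQ HK RK N'(2) by (intro exI[of _ H]) (auto simp: less_imp_le order_trans[OF N'(2)] dest: RK)
qed


text \<open>After \<open>push_far_left\<close>, \<open>pull_left\<close> with a coefficient strictly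
  between \<open>c\<close> and 1 makes the real part at most a negative multiple of the norm, and
  \<open>stretch_left\<close> then lets it outgrow the imaginary part. All these maps fix the unit
  disc.\<close>

lemma push_into_left_sector:
  fixes K :: "complex set"
  assumes "closed K" "\<And>z. z \<in> K \<Longrightarrow> norm z > 1" "connected (- K)"
    and c: "0 < c" "c < 1" and "\<And>z. z \<in> K \<Longrightarrow> norm z \<ge> M \<Longrightarrow> Re z < c * norm z"
    and "N > 0" "\<eta> > 0"
  shows "\<exists>H. proper_embedding H \<and> (\<forall>z\<in>cball 0 1. H z = z)
           \<and> (\<forall>z\<in>K. Re (H z) \<le> - N \<and> \<bar>Im (H z)\<bar> \<le> \<eta> * - Re (H z))"
proof -
  define \<delta> where "\<delta> = (1 - c) / 4"
  \<comment> \<open>Chosen so that \<eta> times the stretched real part dominates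
    \<open>norm (H z)\<close> and with it the unchanged imaginary part.\<close>
  define m where "m = 2 / (\<eta> * \<delta>)"
  have \<delta>: "0 < \<delta>" "\<delta> < 1" using c by (auto simp: \<delta>_def)
  have m: "m > 0" "\<eta> * (m * \<delta> / 2) = 1" using \<delta> \<open>\<eta> > 0\<close> by (auto simp: m_def)
  have N1: "(N + 2) / \<delta> > 1" using \<delta> \<open>N > 0\<close> by (simp add: field_simps)
  obtain H where H: "proper_embedding H" "\<And>z. z \<in> cball 0 1 \<Longrightarrow> H z = z"
    "\<And>z. z \<in> K \<Longrightarrow> Re (H z) < c * norm (H z)" "\<And>z. z \<in> K \<Longrightarrow> norm (H z) \<ge> (N + 2) / \<delta>"
    using push_far_left[OF assms(1-6) N1] by blast
  let ?G = "\<lambda>z. stretch_left m (pull_left ((1 + c) / 2) (H z))"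
  have "proper_embedding ?G"
    using proper_embedding_comp[OF proper_embedding_stretch_left[OF m(1)]
        proper_embedding_comp[OF proper_embedding_pull_left[of "(1 + c) / 2"] H(1)]] c by simp
  moreover have "?G z = z" if "z \<in> cball 0 1" for z
  proof -
    have "- Re z \<le> 1" using that abs_Re_le_cmod[of z] by simp
    then show ?thesis using that H(2)[OF that] by (simp add: pull_left_def stretch_left_def)
  qed
  moreover have "Re (?G z) \<le> - N \<and> \<bar>Im (?G z)\<bar> \<le> \<eta> * - Re (?G z)" if "z \<in> K" for z
  proof -
    let ?r = "norm (H z)" and ?f = "pull_left ((1 + c) / 2) (H z)"
    have r: "\<delta> * ?r \<ge> N + 2" using H(4)[OF that] \<delta> by (simp add: field_simps)
    have "\<delta> * ?r \<le> 1 * ?r" using \<delta> by (intro mult_right_mono) auto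
    then have "?r \<ge> 1" using r \<open>N > 0\<close> by linarith
    then have "Re ?f = Re (H z) - (1 + c) / 2 * (?r - 1)" by (simp add: pull_left_def)
    also have "\<dots> < c * ?r - (1 + c) / 2 * (?r - 1)" using H(3)[OF that] by simp
    also have "\<dots> = - (2 * (\<delta> * ?r)) + (1 + c) / 2" by (simp add: \<delta>_def field_simps)
    also have "\<dots> \<le> - (\<delta> * ?r)" using r \<open>N > 0\<close> c by simp
    finally have f: "Re ?f \<le> - (\<delta> * ?r)" by simp
    then have f2: "Re ?f \<le> - (N + 2)" using r by linarith
    have g: "- Re (?G z) = - Re ?f + m * (- Re ?f - 1)" using f2 \<open>N > 0\<close> by (simp add: stretch_left_def)
    have "m * (- Re ?f - 1) \<ge> 0" using f2 \<open>N > 0\<close> m by simp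
    then have 1: "- Re (?G z) \<ge> N" using g f2 by linarith
    have "m * (\<delta> * ?r / 2) \<le> m * (- Re ?f - 1)" using f f2 \<open>N > 0\<close> m by (intro mult_left_mono) auto
    then have "m * \<delta> / 2 * ?r \<le> - Re (?G z)" using g f2 \<open>N > 0\<close> by (simp add: mult.assoc)
    then have "\<eta> * (m * \<delta> / 2 * ?r) \<le> \<eta> * - Re (?G z)" using \<open>\<eta> > 0\<close> by (intro mult_left_mono) auto
    moreover have "\<eta> * (m * \<delta> / 2 * ?r) = ?r" using m(2) by (metis mult.assoc mult_1)
    ultimately have "?r \<le> \<eta> * - Re (?G z)" by (simp only:)
    moreover have "Im (?G z) = Im (H z)" by (simp add: pull_left_def stretch_left_def)
    ultimately show ?thesis using 1 abs_Im_le_cmod[of "H z"] by simp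
  qed
  ultimately show ?thesis by blast
qed

section \<open>Inversion and contraction into a sector at the origin\<close>

lemma sgn_inverse_complex: "sgn (inverse z) = cnj (sgn z)"
proof (cases "z = 0")
  case False
  have "inverse z * complex_of_real (norm z) = cnj z / complex_of_real (norm z)"
    using False complex_norm_square[of z] by (simp add: field_simps power2_eq_square)
  then show ?thesis using False by (simp add: sgn_eq norm_inverse divide_inverse)
qed simp

text \<open>Properness gives continuity at the origin; the convention \<open>inverse 0 = 0\<close>
  together with \<open>H 0 = 0\<close> supplies the right value there.\<close>

lemma plane_embedding_inversion:
  assumes H: "proper_embedding H" "H 0 = 0"
  shows "plane_embedding (\<lambda>z. inverse (H (inverse z)))"
proof -
  have cont: "isCont H x" for x
    using H(1) by (simp add: proper_embedding_def plane_embedding_def continuous_on_eq_continuous_at)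
  have inj: "H x = H y \<longleftrightarrow> x = y" for x y
    using H(1) by (auto simp: proper_embedding_def plane_embedding_def inj_on_def)
  have "isCont (\<lambda>z. inverse (H (inverse z))) z" for z
  proof (cases "z = 0")
    case True
    have "filterlim (\<lambda>z. H (inverse z)) at_infinity (at 0)"
      using H(1) filterlim_inverse_at_infinity unfolding proper_embedding_def
      by (blast intro: filterlim_compose)
    then have "((\<lambda>z. inverse (H (inverse z))) \<longlongrightarrow> 0) (at 0)"
      using filterlim_compose tendsto_inverse_0 by blast
    then show ?thesis using True H(2) by (simp add: isCont_def)
  next
    case False
    then have "H (inverse z) \<noteq> 0" using inj[of "inverse z" 0] H(2) by simp
    moreover have "isCont (\<lambda>z. H (inverse z)) z" 
      using isCont_o2[OF continuous_at_within_inverse[OF continuous_ident] cont] False by simp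
    ultimately show ?thesis by (rule continuous_at_within_inverse[rotated])
  qed
  then have "continuous_on UNIV (\<lambda>z. inverse (H (inverse z)))"
    by (simp add: continuous_on_eq_continuous_at)
  moreover have "inj (\<lambda>z. inverse (H (inverse z)))" by (simp add: inj_on_def inj)
  ultimately show ?thesis unfolding plane_embedding_def by blast
qed

text \<open>Inversion makes the outside of the unit disc the region that \<open>H\<close> fixes, and
  turns the free sector of \<open>K\<close> around direction 1 into a sector at infinity that the
  inverted set avoids. Points pushed far to the left come back as points near 0 in directions near
  -1.\<close>

lemma into_thin_sector_at_origin:
  fixes K :: "complex set"
  assumes "compact K" "K \<subseteq> ball 0 1" "0 \<in> K" "connected (- K)"
    and "e > 0" and free: "\<And>z. z \<in> K \<Longrightarrow> z \<noteq> 0 \<Longrightarrow> norm z < e \<Longrightarrow> e \<le> norm (sgn z - 1)"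
    and "\<delta> > 0"
  shows "\<exists>h. plane_embedding h \<and> h 0 = 0 \<and> (\<forall>z. norm z \<ge> 1 \<longrightarrow> h z = z)
           \<and> (\<forall>z\<in>K - {0}. norm (h z) < \<delta> \<and> norm (sgn (h z) + 1) < \<delta>)"
proof -
  define K' where "K' = inverse ` (K - {0})"
  have K'_iff: "z \<in> K' \<longleftrightarrow> z \<noteq> 0 \<and> inverse z \<in> K" for z
    unfolding K'_def by (auto simp: image_iff intro: bexI[of _ "inverse z"])
  have big: "norm z > 1" if "z \<in> K'" for z
  proof -
    have "inverse (norm z) < 1" "z \<noteq> 0" using that assms(2) by (auto simp: K'_iff norm_inverse)
    then show ?thesis using inverse_less_1_iff by (metis inverse_less_1_iff linorder_not_less norm_le_zero_iff)
  qed
  have "closed K'"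
  proof -
    have "closed {z. norm z \<ge> 1 \<and> inverse z \<in> K}"
    proof -
      have "continuous_on {z. norm z \<ge> 1} (inverse :: complex \<Rightarrow> complex)"
        by (intro continuous_intros) auto
      then have "closed ({z. norm z \<ge> 1} \<inter> inverse -` K)"
        using \<open>compact K\<close> by (intro continuous_closed_preimage closed_Collect_le)
          (auto intro: continuous_intros compact_imp_closed)
      then show ?thesis by (simp add: vimage_def Collect_conj_eq)
    qed
    moreover have "K' = {z. norm z \<ge> 1 \<and> inverse z \<in> K}" using big K'_iff by force
    ultimately show ?thesis by simp
  qed
  \<comment> \<open>The complement of \<open>K'\<close> is the inverted complement of
    \<open>K\<close> with 0 added, and 0 is a limit of inverses of points far away.\<close>
  have "connected (- K')"
  proof (rule connected_intermediate_closure)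
    show "connected (inverse ` (- K))"
      using assms(3,4) by (intro connected_continuous_image continuous_intros) auto
    have eq: "- K' = insert 0 (inverse ` (- K))"
      using assms(3) by (auto simp: K'_iff image_iff) (metis ComplI inverse_inverse_eq)
    then show "inverse ` (- K) \<subseteq> - K'" by blast
    have "0 \<in> closure (inverse ` (- K))"
      unfolding closure_approachable
    proof (intro allI impI)
      fix d :: real assume "d > 0"
      let ?z = "complex_of_real (1 + 1 / d)"
      have nz: "norm ?z = 1 + 1 / d" using \<open>d > 0\<close> by (simp only: norm_of_real) simp
      then have "?z \<in> - K" using assms(2) \<open>d > 0\<close> by force
      moreover have "dist (inverse ?z) 0 < d"
        unfolding dist_norm diff_zero norm_inverse nz using \<open>d > 0\<close> by (simp add: field_simps)
      ultimately show "\<exists>y\<in>inverse ` (- K). dist y 0 < d" by blast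
    qed
    then show "- K' \<subseteq> closure (inverse ` (- K))" unfolding eq by (simp add: closure_subset)
  qed
  \<comment> \<open>On the unit circle, distance at least \<open>e\<close> from 1 means real part at
    most \<open>1 - e\<^sup>2 / 2\<close>; \<open>c\<close> is strictly larger, and the maximum
    keeps it positive.\<close>
  define c where "c = max (1/2) (1 - e\<^sup>2 / 4)"
  have c: "0 < c" "c < 1" using \<open>e > 0\<close> by (auto simp: c_def)
  have sector: "Re z < c * norm z" if "z \<in> K'" "norm z \<ge> 2 / e" for z
  proof -
    have z0: "z \<noteq> 0" "inverse z \<in> K" "norm z > 0" using that K'_iff by auto
    have "inverse (norm z) \<le> e / 2" using that(2) z0(3) \<open>e > 0\<close> by (simp add: field_simps)
    then have "norm (inverse z) \<le> e / 2" by (simp add: norm_inverse)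
    then have "e \<le> norm (sgn (inverse z) - 1)" using free[OF z0(2)] z0 \<open>e > 0\<close> by simp
    then have "e\<^sup>2 \<le> (norm (cnj (sgn z) - 1))\<^sup>2"
      using \<open>e > 0\<close> by (intro power_mono) (auto simp: sgn_inverse_complex simp del: sgn_inverse)
    also have "\<dots> = (norm (sgn z))\<^sup>2 + 1 - 2 * Re (sgn z)"
      unfolding cmod_power2 by (simp add: power2_eq_square algebra_simps)
    also have "\<dots> = 2 - 2 * Re (sgn z)" using z0 by (simp add: norm_sgn)
    finally have "Re (sgn z) \<le> 1 - e\<^sup>2 / 2" by simp
    moreover have "1 - e\<^sup>2 / 2 < c" using \<open>e > 0\<close> by (auto simp: c_def less_max_iff_disj)
    ultimately have "Re (sgn z) < c" by linarith
    then show ?thesis using z0 by (simp add: sgn_eq field_simps)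
  qed
  obtain H where H: "proper_embedding H" "\<And>z. z \<in> cball 0 1 \<Longrightarrow> H z = z"
    "\<And>z. z \<in> K' \<Longrightarrow> Re (H z) \<le> - (2 / \<delta>)" "\<And>z. z \<in> K' \<Longrightarrow> \<bar>Im (H z)\<bar> \<le> \<delta> / 4 * - Re (H z)"
    using push_into_left_sector[of K' c "2 / e" "2 / \<delta>" "\<delta> / 4"] \<open>closed K'\<close> big \<open>connected (- K')\<close> c sector \<open>\<delta> > 0\<close>
    by auto
  show ?thesis
  proof (intro exI conjI ballI allI impI)
    show "plane_embedding (\<lambda>z. inverse (H (inverse z)))"
      using plane_embedding_inversion H(1,2) by simp
    show "inverse (H (inverse 0)) = 0" using H(2)[of 0] by simp
    show "inverse (H (inverse z)) = z" if "norm z \<ge> 1" for z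
      using H(2)[of "inverse z"] that by (simp add: norm_inverse inverse_le_1_iff)
    fix z assume "z \<in> K - {0}"
    then have K': "inverse z \<in> K'" by (simp add: K'_iff)
    let ?y = "H (inverse z)"
    have y: "Re ?y \<le> - (2 / \<delta>)" "\<bar>Im ?y\<bar> \<le> \<delta> / 4 * - Re ?y" using H(3,4)[OF K'] .
    have n: "norm ?y \<ge> - Re ?y" using abs_Re_le_cmod[of ?y] by linarith
    then have n2: "norm ?y \<ge> 2 / \<delta>" using y(1) by linarith
    moreover have "2 / \<delta> > 0" using \<open>\<delta> > 0\<close> by simp
    ultimately have n0: "norm ?y > 0" by linarith
    have "norm (inverse ?y) = 1 / norm ?y" by (simp add: norm_inverse divide_inverse)
    also have "\<dots> \<le> 1 / (2 / \<delta>)" using n2 n0 \<open>\<delta> > 0\<close> by (intro divide_left_mono) auto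
    also have "\<dots> < \<delta>" using \<open>\<delta> > 0\<close> by simp
    finally show "norm (inverse ?y) < \<delta>" .
    have "norm (?y + norm ?y) \<le> \<bar>Re (?y + norm ?y)\<bar> + \<bar>Im (?y + norm ?y)\<bar>" by (rule cmod_le)
    also have "\<dots> = (Re ?y + norm ?y) + \<bar>Im ?y\<bar>" using n by simp
    also have "\<dots> \<le> 2 * \<bar>Im ?y\<bar>"
      using cmod_le[of ?y] y(1) \<open>2 / \<delta> > 0\<close> by simp
    also have "\<delta> / 4 * - Re ?y \<le> \<delta> / 4 * norm ?y" using n \<open>\<delta> > 0\<close> by (intro mult_left_mono) auto
    then have "2 * \<bar>Im ?y\<bar> \<le> \<delta> / 2 * norm ?y" using y(2) by linarith
    also have "\<dots> < \<delta> * norm ?y" using n0 \<open>\<delta> > 0\<close> by simp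
    finally have "norm (?y + norm ?y) / norm ?y < \<delta>" using n0 by (simp add: field_simps)
    moreover have "sgn ?y + 1 = (?y + norm ?y) / norm ?y"
      using n0 by (simp add: sgn_eq add_divide_distrib)
    then have "norm (sgn ?y + 1) = norm (?y + norm ?y) / norm ?y" by (simp add: norm_divide)
    moreover have "norm (sgn (inverse ?y) + 1) = norm (cnj (sgn ?y + 1))" by (simp add: sgn_inverse_complex del: sgn_inverse)
    then have "norm (sgn (inverse ?y) + 1) = norm (sgn ?y + 1)" by (simp only: complex_mod_cnj)
    ultimately show "norm (sgn (inverse ?y) + 1) < \<delta>" by simp
  qed
qed


section \<open>Rotation near a point and free sectors\<close>

definition twist :: "real \<Rightarrow> complex \<Rightarrow> complex" where
  "twist \<theta> z = z * cis (\<theta> * bump (1 / 2) (norm z))"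

lemma plane_embedding_twist: "plane_embedding (twist \<theta>)"
proof -
  have "continuous_on UNIV (twist \<theta>)"
    unfolding twist_def[abs_def] bump_def cis_conv_exp by (intro continuous_intros) auto
  moreover have "inj (twist \<theta>)"
  proof (rule injI)
    fix x y assume eq: "twist \<theta> x = twist \<theta> y"
    have "norm x = norm y" using arg_cong[OF eq, of norm] by (simp add: twist_def norm_mult)
    then show "x = y" using eq by (simp add: twist_def)
  qed
  ultimately show ?thesis by (simp add: plane_embedding_def)
qed

lemma twist_far: "norm z \<ge> 1 \<Longrightarrow> twist \<theta> z = z"
  by (simp add: twist_def bump_def)

lemma twist_near: "norm z \<le> 1 / 2 \<Longrightarrow> twist \<theta> z = z * cis \<theta>"
  by (simp add: twist_def bump_def)

text \<open>Some sector with apex \<open>w\<close> is free of \<open>X\<close>: \<open>d\<close> is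
  its direction, and the single number \<open>e\<close> bounds both its radius and its opening.
  Directions are compared through \<open>sgn\<close>, which avoids angles.\<close>

definition free_at :: "complex set \<Rightarrow> complex \<Rightarrow> bool" where
  "free_at X w \<longleftrightarrow> (\<exists>d e. norm d = 1 \<and> e > 0 \<and>
     (\<forall>z\<in>X. z \<noteq> w \<longrightarrow> dist z w < e \<longrightarrow> e \<le> norm (sgn (z - w) - d)))"

definition thin_sector :: "complex \<Rightarrow> complex \<Rightarrow> real \<Rightarrow> complex set" where
  "thin_sector w d e = {z. z \<noteq> w \<and> dist z w < e \<and> norm (sgn (z - w) - d) < e}"

text \<open>An affine map takes \<open>w\<close> to 0, the disc to the unit disc and the free
  direction to 1. The contraction then leads into direction -1, and a rotation near 0 turns this
  into the prescribed direction \<open>d\<close>.\<close>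

lemma move_into_thin_sector:
  assumes "compact K" "w \<in> K" "K \<subseteq> ball w r" "r > 0" "connected (- K)" "free_at K w"
    and d: "norm d = 1" and "\<delta> > 0"
  shows "\<exists>h. plane_embedding h \<and> h w = w \<and> (\<forall>z. z \<notin> ball w r \<longrightarrow> h z = z) \<and> h ` (K - {w}) \<subseteq> thin_sector w d \<delta>"
proof -
  obtain d0 e where d0: "norm d0 = 1" "e > 0"
    "\<And>z. z \<in> K \<Longrightarrow> z \<noteq> w \<Longrightarrow> dist z w < e \<Longrightarrow> e \<le> norm (sgn (z - w) - d0)"
    using assms(6) unfolding free_at_def by blast
  have d00: "d0 \<noteq> 0" using d0(1) by auto
  define a where "a = complex_of_real r * d0"
  have a: "a \<noteq> 0" "norm a = r" using d00 \<open>r > 0\<close> d0(1) by (auto simp: a_def norm_mult)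
  have sgn_a: "sgn a = d0" using d0(1) \<open>r > 0\<close> by (simp add: a_def sgn_mult sgn_eq[of d0] sgn_of_real)
  let ?f = "\<lambda>z. (z - w) / a"
  define L where "L = ?f ` K"
  have "norm (- d / d0) = 1" using d d0(1) by (simp add: norm_divide)
  \<comment> \<open>Multiplication by \<open>a\<close> and by this \<open>cis \<theta>\<close> turns
    direction -1 into \<open>d\<close>.\<close>
  then obtain \<theta> where \<theta>: "cis \<theta> = - d / d0"
    using complex_norm_eq_1_exp[of "- d / d0"] unfolding cis_conv_exp by metis
  have L_iff: "z \<in> L \<longleftrightarrow> w + a * z \<in> K" for z
    unfolding L_def using a by (auto simp: image_iff field_simps intro: bexI[of _ "w + a * z"])
  have "compact L" unfolding L_def using assms(1) a by (intro compact_continuous_image continuous_intros) auto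
  moreover have "L \<subseteq> ball 0 1"
    unfolding L_def using assms(3) a \<open>r > 0\<close> by (auto simp: dist_norm norm_divide norm_minus_commute)
  moreover have "0 \<in> L" using L_iff[of 0] \<open>w \<in> K\<close> by simp
  moreover have "connected (- L)"
  proof -
    have "- L = ?f ` (- K)"
      using a by (auto simp: L_iff image_iff field_simps intro: bexI[of _ "w + a * _"])
    then show ?thesis using assms(5) a by (auto intro!: connected_continuous_image continuous_intros)
  qed
  moreover have "min e (e / r) > 0" using d0(2) \<open>r > 0\<close> by simp
  moreover have "min e (e / r) \<le> norm (sgn z - 1)" if "z \<in> L" "z \<noteq> 0" "norm z < min e (e / r)" for z
  proof -
    have "e \<le> norm (sgn (a * z) - d0)"
      using d0(3)[of "w + a * z"] that a \<open>r > 0\<close> L_iff by (simp add: dist_norm norm_mult field_simps)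
    also have "sgn (a * z) - d0 = d0 * (sgn z - 1)" by (simp add: sgn_mult sgn_a algebra_simps)
    finally show ?thesis using d0(1) by (simp add: norm_mult)
  qed
  \<comment> \<open>The bound 1 / 2 keeps the contracted set where \<open>twist\<close> is a plain
    rotation; the division by \<open>r\<close> accounts for the scaling.\<close>
  moreover have "min (1 / 2) (min \<delta> (\<delta> / r)) > 0" using \<open>\<delta> > 0\<close> \<open>r > 0\<close> by simp
  ultimately obtain h where h: "plane_embedding h" "h 0 = 0" "\<And>z. norm z \<ge> 1 \<Longrightarrow> h z = z"
    "\<And>z. z \<in> L - {0} \<Longrightarrow> norm (h z) < min (1 / 2) (min \<delta> (\<delta> / r))"
    "\<And>z. z \<in> L - {0} \<Longrightarrow> norm (sgn (h z) + 1) < min (1 / 2) (min \<delta> (\<delta> / r))"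
    using into_thin_sector_at_origin[of L "min e (e / r)" "min (1 / 2) (min \<delta> (\<delta> / r))"] by metis
  let ?h = "\<lambda>z. a * twist \<theta> (h (?f z)) + w"
  have "plane_embedding (\<lambda>z. (1 / a) * (z + - w))"
    using a by (intro plane_embedding_comp[OF plane_embedding_mult plane_embedding_add]) auto
  then have "plane_embedding ?f" by (simp add: divide_inverse mult.commute)
  then have "plane_embedding ?h"
    using plane_embedding_comp[OF plane_embedding_add plane_embedding_comp[OF plane_embedding_mult[OF a(1)]
      plane_embedding_comp[OF plane_embedding_twist plane_embedding_comp[OF h(1)]]]] by blast
  moreover have "?h w = w" using h(2) by (simp add: twist_def)
  moreover have "?h z = z" if "z \<notin> ball w r" for z
  proof -
    have "norm (?f z) \<ge> 1" using that a \<open>r > 0\<close> by (simp add: norm_divide dist_norm norm_minus_commute)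
    then show ?thesis using a by (simp add: h(3) twist_far)
  qed
  moreover have "?h z \<in> thin_sector w d \<delta>" if "z \<in> K - {w}" for z
  proof -
    have L: "?f z \<in> L - {0}" using that a by (auto simp: L_iff)
    let ?y = "h (?f z)"
    have y: "norm ?y < 1 / 2" "norm ?y < \<delta> / r" "norm (sgn ?y + 1) < \<delta>" using h(4,5)[OF L] by auto
    have "?y \<noteq> 0" using L h(1,2) unfolding plane_embedding_def inj_def by (metis Diff_iff singletonI)
    have e: "?h z - w = a * ?y * cis \<theta>" using y(1) by (simp add: twist_near)
    then have 1: "?h z \<noteq> w" using a(1) \<open>?y \<noteq> 0\<close> by auto
    have "dist (?h z) w = r * norm ?y" unfolding dist_norm e by (simp add: norm_mult a(2))
    then have 2: "dist (?h z) w < \<delta>" using y(2) \<open>r > 0\<close> by (simp add: field_simps)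
    have "sgn (?h z - w) = d0 * sgn ?y * cis \<theta>" unfolding e by (simp add: sgn_mult sgn_a sgn_eq[of "cis \<theta>"])
    also have "\<dots> = - d * sgn ?y" using \<theta> d00 by simp
    finally have "sgn (?h z - w) - d = - d * (sgn ?y + 1)" by (simp add: algebra_simps)
    then have "norm (sgn (?h z - w) - d) = norm (sgn ?y + 1)" using d by (simp add: norm_mult)
    then show ?thesis using 1 2 y(3) unfolding thin_sector_def by simp
  qed
  ultimately show ?thesis by blast
qed

subsection \<open>Shrinking a non-separating continuum\<close>

text \<open>A closed connected set \<open>X\<close> that contains the complement of \<open>U\<close>
  and misses \<open>K\<close> is built from the outside of a large disc and from finitely many discs
  joined to it by paths in the complement of \<open>K\<close>. The component of \<open>- X\<close>
  that contains \<open>K\<close> has no holes.\<close>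

lemma simply_connected_neighbourhood:
  fixes K :: "complex set"
  assumes "compact K" "connected K" "K \<noteq> {}" "connected (- K)" "open U" "K \<subseteq> U"
  shows "\<exists>W. open W \<and> simply_connected W \<and> K \<subseteq> W \<and> W \<subseteq> U"
proof -
  obtain B where B: "B > 0" "K \<subseteq> ball 0 B"
    using bounded_subset_ballD[OF compact_imp_bounded[OF \<open>compact K\<close>], of 0] by blast
  define L where "L = cball 0 B - U"
  have "compact L" unfolding L_def using \<open>open U\<close> by (simp add: compact_diff)
  define b where "b = complex_of_real (B + 1)"
  have nb: "norm b = B + 1" unfolding b_def using B(1) by (simp only: norm_of_real)
  have oK: "open (- K)" using \<open>compact K\<close> by (simp add: compact_imp_closed open_Compl)
  have "\<exists>r C. r > 0 \<and> ball x r \<subseteq> C \<and> connected C \<and> closed C \<and> b \<in> C \<and> C \<inter> K = {}" if "x \<in> L" for x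
  proof -
    have xK: "x \<in> - K" "b \<in> - K" using that assms(6) B(2) nb by (auto simp: L_def)
    obtain r where r: "r > 0" "cball x r \<subseteq> - K" using oK xK(1) open_contains_cball by blast
    have "path_connected (- K)" using oK \<open>connected (- K)\<close> connected_open_path_connected by blast
    then obtain g where g: "path g" "path_image g \<subseteq> - K" "pathstart g = x" "pathfinish g = b"
      using xK unfolding path_connected_def by blast
    show ?thesis
    proof (intro exI conjI)
      show "connected (cball x r \<union> path_image g)"
      proof (rule connected_Un)
        have "x \<in> cball x r \<inter> path_image g" using r(1) g(3) pathstart_in_path_image[of g] by simp
        then show "cball x r \<inter> path_image g \<noteq> {}" by blast
      qed (simp_all add: connected_path_image[OF g(1)])
      show "closed (cball x r \<union> path_image g)" using g(1) by (intro closed_Un closed_cball compact_imp_closed compact_path_image)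
      show "b \<in> cball x r \<union> path_image g" using g(4) pathfinish_in_path_image[of g] by auto
      show "(cball x r \<union> path_image g) \<inter> K = {}" using r g by auto
    qed (use r(1) in auto)
  qed
  then obtain r C where C: "\<And>x. x \<in> L \<Longrightarrow> r x > 0 \<and> ball x (r x) \<subseteq> C x \<and> connected (C x) \<and> closed (C x)
      \<and> b \<in> C x \<and> C x \<inter> K = {}" by metis
  obtain D where D: "D \<subseteq> L" "finite D" "L \<subseteq> (\<Union>x\<in>D. ball x (r x))"
    using compactE_image[OF \<open>compact L\<close>, of L "\<lambda>x. ball x (r x)"] C by force
  \<comment> \<open>Every member contains the point \<open>b\<close>, so the union is connected;
    compactness of \<open>L\<close> makes it a finite union and hence closed.\<close>
  define X where "X = \<Union> (insert (- ball 0 B) (C ` D))"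
  have "b \<in> - ball 0 B" using nb by simp
  then have "b \<in> \<Inter> (insert (- ball 0 B) (C ` D))" using C D(1) by auto
  moreover have "connected S" if "S \<in> insert (- ball 0 B) (C ` D)" for S
    using that C D(1) connected_complement_bounded_convex[of "ball (0::complex) B"] by auto
  ultimately have "connected X" unfolding X_def by (intro connected_Union) blast+
  have "closed X" unfolding X_def
  proof (intro closed_Union ballI)
    show "finite (insert (- ball 0 B) (C ` D))" using D(2) by simp
    show "closed S" if "S \<in> insert (- ball 0 B) (C ` D)" for S using that C D(1) by fastforce
  qed
  have XK: "X \<inter> K = {}" using C D(1) B(2) unfolding X_def by fastforce
  have XU: "- X \<subseteq> U"
  proof
    fix y assume y: "y \<in> - X"
    then have "y \<in> ball 0 B" unfolding X_def by auto
    moreover have "y \<notin> L"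
    proof
      assume "y \<in> L"
      then obtain x where "x \<in> D" "y \<in> ball x (r x)" using D(3) by blast
      then show False using y C D(1) unfolding X_def by blast
    qed
    ultimately show "y \<in> U" by (simp add: L_def)
  qed
  obtain k where "k \<in> K" using \<open>K \<noteq> {}\<close> by blast
  define W where "W = connected_component_set (- X) k"
  have "open W" unfolding W_def using \<open>closed X\<close> by (simp add: open_connected_component open_Compl)
  have KW: "K \<subseteq> W" unfolding W_def using \<open>k \<in> K\<close> \<open>connected K\<close> XK by (intro connected_component_maximal) auto
  have WX: "W \<subseteq> - X" unfolding W_def by (rule connected_component_subset)
  then have "W \<subseteq> ball 0 B" unfolding X_def by auto
  then have "bounded W" using bounded_ball bounded_subset by blast
  have "k \<in> - X" using \<open>k \<in> K\<close> XK by auto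
  then have "W \<in> components (- X)" unfolding W_def by (rule componentsI)
  \<comment> \<open>The complement of a component of \<open>- X\<close> is connected because
    \<open>X\<close> is; for a bounded connected open set this amounts to simple
    connectivity.\<close>
  then have "connected (- W)" using \<open>connected X\<close> by (rule component_complement_connected[rotated])
  moreover have "connected W" unfolding W_def by (rule connected_connected_component)
  ultimately have "simply_connected W"
    using simply_connected_iff_simple \<open>open W\<close> \<open>bounded W\<close> by blast
  then show ?thesis using \<open>open W\<close> KW WX XU by blast
qed

text \<open>By the Riemann mapping theorem a simply connected neighbourhood of \<open>K\<close> is
  homeomorphic to the plane. There \<open>K\<close> becomes a bounded set, which
  \<open>squash\<close> contracts towards the image of \<open>w\<close>; conjugating back and
  extending by the identity gives \<open>h\<close>.\<close>

lemma shrink_into_ball: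
  fixes K :: "complex set"
  assumes "compact K" "connected K" "connected (- K)" "w \<in> K" "open U" "K \<subseteq> U" "r > 0"
  shows "\<exists>h. plane_embedding h \<and> h w = w \<and> (\<forall>z. z \<notin> U \<longrightarrow> h z = z) \<and> h ` K \<subseteq> ball w r"
proof -
  obtain W where W: "open W" "simply_connected W" "K \<subseteq> W" "W \<subseteq> U"
    using simply_connected_neighbourhood[of K U] assms by auto
  have "W homeomorphic ball (0::complex) 1"
    using simply_connected_eq_homeomorphic_to_disc[OF W(1)] W(2,3) assms(4) by blast
  then have "W homeomorphic (UNIV :: complex set)"
    using homeomorphic_ball01_UNIV homeomorphic_trans by blast
  then obtain f0 g0 where fg0: "homeomorphism W (UNIV :: complex set) f0 g0"
    unfolding homeomorphic_def by blast
  define f where "f z = f0 z - f0 w" for z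
  define g where "g y = g0 (y + f0 w)" for y
  have gf: "g (f z) = z" if "z \<in> W" for z
    using fg0 that by (simp add: f_def g_def homeomorphism_def)
  have fg: "f (g y) = y" "g y \<in> W" for y
    using fg0 by (auto simp: f_def g_def homeomorphism_def)
  have cf: "continuous_on W f" using fg0 unfolding f_def[abs_def] homeomorphism_def
    by (intro continuous_intros) auto
  have "continuous_on UNIV g0" using fg0 by (simp add: homeomorphism_def)
  then have cg: "continuous_on UNIV g" unfolding g_def[abs_def]
    by (rule continuous_on_compose2) (auto intro: continuous_intros)
  have fw: "f w = 0" "g 0 = w" using gf[of w] W(3) assms(4) by (auto simp: f_def)
  have "compact (f ` K)" using assms(1) W(3) cf continuous_on_subset by (blast intro: compact_continuous_image)
  then obtain M where M: "M > 0" "f ` K \<subseteq> ball 0 M"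
    using bounded_subset_ballD[OF compact_imp_bounded, of "f ` K" 0] by blast
  have "isCont g 0" using cg by (simp add: continuous_on_eq_continuous_at)
  then obtain s where s: "s > 0" "\<And>y. dist y 0 < s \<Longrightarrow> dist (g y) w < r"
    using \<open>r > 0\<close> fw(2) unfolding continuous_at_eps_delta by metis
  \<comment> \<open>\<open>s\<close> comes from continuity of \<open>g\<close> at 0: contraction to
    a radius below \<open>s\<close> brings the image within \<open>r\<close> of
    \<open>w\<close>.\<close>
  define \<epsilon> where "\<epsilon> = min (s / 2) M"
  have \<epsilon>: "0 < \<epsilon>" "\<epsilon> < M + 1" "\<epsilon> < s" using s(1) M(1) by (auto simp: \<epsilon>_def)
  define q where "q = squash M \<epsilon> (M + 1)"
  have q: "plane_embedding q" unfolding q_def using M(1) \<epsilon> by (intro plane_embedding_squash) auto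
  define h where "h z = (if z \<in> W then g (q (f z)) else z)" for z
  define C where "C = g ` cball 0 (M + 1)"
  have "compact C" unfolding C_def using cg continuous_on_subset
    by (intro compact_continuous_image) auto
  have hC: "h z = z" if "z \<notin> C" for z
  proof (cases "z \<in> W")
    case True
    have "f z \<notin> cball 0 (M + 1)" using that gf[OF True] unfolding C_def by (metis imageI)
    then have "q (f z) = f z" unfolding q_def using M(1) by (intro squash_large) auto
    then show ?thesis using True gf by (simp add: h_def)
  qed (simp add: h_def)
  \<comment> \<open>\<open>h\<close> is the identity off the compact set \<open>C\<close>, so it is
    continuous on each of the open sets \<open>W\<close> and \<open>- C\<close>, which cover the
    plane.\<close>
  have "continuous_on (\<Union> {W, - C}) h"
  proof (rule continuous_on_open_Union)
    show "open S" if "S \<in> {W, - C}" for S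
      using that W(1) \<open>compact C\<close> by (auto simp: compact_imp_closed open_Compl)
    have "continuous_on W (\<lambda>z. q (f z))"
      using q cf continuous_on_compose2[of UNIV q W f] by (simp add: plane_embedding_def)
    then have "continuous_on W (\<lambda>z. g (q (f z)))"
      using cg continuous_on_compose2[of UNIV g W "\<lambda>z. q (f z)"] by simp
    then have "continuous_on W h" by (rule continuous_on_eq) (simp add: h_def)
    moreover have "continuous_on (- C) h"
      by (rule continuous_on_eq[OF continuous_on_id]) (simp add: hC)
    ultimately show "continuous_on S h" if "S \<in> {W, - C}" for S using that by blast
  qed
  moreover have "\<Union> {W, - C} = UNIV" using fg(2) by (auto simp: C_def)
  moreover have "inj h"
  proof (rule injI)
    fix x y assume eq: "h x = h y"
    have "q (f x) = q (f y)" if "x \<in> W" "y \<in> W"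
      using eq that fg(1) by (metis h_def)
    then have "f x = f y" if "x \<in> W" "y \<in> W"
      using that q by (auto simp: plane_embedding_def inj_def)
    then show "x = y" using eq gf fg(2) unfolding h_def by (metis (full_types))
  qed
  ultimately have "plane_embedding h" by (simp add: plane_embedding_def)
  moreover have "h w = w" using fw W(3) assms(4) M(1) by (auto simp: h_def q_def squash_small)
  moreover have "h z = z" if "z \<notin> U" for z using that W(4) by (auto simp: h_def)
  moreover have "h z \<in> ball w r" if "z \<in> K" for z
  proof -
    have n: "norm (f z) \<le> M" using M(2) that by force
    then have "norm (q (f z)) = \<epsilon> / M * norm (f z)" unfolding q_def using \<epsilon> M(1) by (simp add: squash_small)
    also have "\<dots> \<le> \<epsilon> / M * M" using n \<epsilon> M(1) by (intro mult_left_mono) auto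
    also have "\<dots> < s" using \<epsilon> M(1) by simp
    finally show ?thesis using s(2)[of "q (f z)"] that W(3) by (auto simp: h_def dist_commute)
  qed
  ultimately show ?thesis by blast
qed

subsection \<open>Forests\<close>

definition adj :: "'v set set \<Rightarrow> ('v \<times> 'v) set" where
  "adj E = {(x, y). {x, y} \<in> E}"

text \<open>Acyclicity in the form that every edge is a bridge, which passes to subsets by
  monotonicity of reachability and avoids lists of vertices.\<close>

definition forest :: "'v set set \<Rightarrow> bool" where
  "forest F \<longleftrightarrow> (\<forall>u v. {u, v} \<in> F \<longrightarrow> u \<noteq> v \<longrightarrow> (u, v) \<notin> (adj (F - {{u, v}}))\<^sup>*)"

lemma adj_mono: "E \<subseteq> F \<Longrightarrow> (adj E)\<^sup>* \<subseteq> (adj F)\<^sup>*"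
  unfolding adj_def by (intro rtrancl_mono) auto

lemma adj_sym: "(u, v) \<in> (adj E)\<^sup>* \<Longrightarrow> (v, u) \<in> (adj E)\<^sup>*"
proof -
  have "sym ((adj E)\<^sup>*)" by (intro sym_rtrancl) (auto simp: sym_def adj_def insert_commute)
  then show "(u, v) \<in> (adj E)\<^sup>* \<Longrightarrow> (v, u) \<in> (adj E)\<^sup>*" by (simp add: sym_def)
qed

lemma forest_subset: "forest F \<Longrightarrow> E \<subseteq> F \<Longrightarrow> forest E"
  unfolding forest_def using adj_mono[of "E - _" "F - _"] by (meson Diff_mono order_refl subsetD)

text \<open>Walk forward along edges: \<open>C u v\<close> collects what is reachable from
  \<open>v\<close> without the edge \<open>{u, v}\<close>. If \<open>v\<close> is not a leaf,
  another edge \<open>{v, x}\<close> gives a strictly smaller set \<open>C v x\<close>, so the walk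
  ends.\<close>

lemma forest_leaf:
  assumes "finite F" "forest F" "F \<noteq> {}" and two: "\<And>e. e \<in> F \<Longrightarrow> card e = 2"
  shows "\<exists>u v. {u, v} \<in> F \<and> u \<noteq> v \<and> v \<notin> \<Union> (F - {{u, v}})"
proof -
  define C where "C u v = {x. (v, x) \<in> (adj (F - {{u, v}}))\<^sup>*}" for u v
  have "finite e" if "e \<in> F" for e using two[OF that] card.infinite by fastforce
  then have "finite (\<Union> F)" using \<open>finite F\<close> by blast
  moreover have "C u v \<subseteq> insert v (\<Union> F)" for u v
  proof
    fix x assume "x \<in> C u v"
    then have "(v, x) \<in> (adj (F - {{u, v}}))\<^sup>*" by (simp add: C_def)
    then show "x \<in> insert v (\<Union> F)" by cases (auto simp: adj_def)
  qed
  ultimately have fin: "finite (C u v)" for u v by (meson finite_insert finite_subset)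
  have "\<exists>u v. {u, v} \<in> F \<and> u \<noteq> v \<and> v \<notin> \<Union> (F - {{u, v}})" if "{u, v} \<in> F" "u \<noteq> v" for u v
    using that
  proof (induction "card (C u v)" arbitrary: u v rule: less_induct)
    case less
    show ?case
    proof (cases "v \<in> \<Union> (F - {{u, v}})")
      case True
      then obtain f where f: "f \<in> F" "f \<noteq> {u, v}" "v \<in> f" by blast
      obtain x where x: "f = {v, x}" "x \<noteq> v"
        using two[OF f(1)] f(3) by (auto simp: card_2_iff)
      have nv: "(x, v) \<notin> (adj (F - {{v, x}}))\<^sup>*"
      proof -
        have "(v, x) \<notin> (adj (F - {{v, x}}))\<^sup>*"
          using \<open>forest F\<close> f(1) x unfolding forest_def by simp
        then show ?thesis using adj_sym[of x v "F - {{v, x}}"] by blast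
      qed
      \<comment> \<open>Without \<open>{v, x}\<close> the bridge property keeps every walk from
        \<open>x\<close> away from \<open>v\<close>, so it never uses \<open>{u, v}\<close> and can
        be started at \<open>v\<close> instead.\<close>
      have "(v, y) \<in> (adj (F - {{u, v}}))\<^sup>* \<and> y \<noteq> v" if "(x, y) \<in> (adj (F - {{v, x}}))\<^sup>*" for y
        using that
      proof (induction rule: rtrancl_induct)
        case base
        show ?case using f x by (auto simp: adj_def)
      next
        case (step y z)
        have "(x, z) \<in> (adj (F - {{v, x}}))\<^sup>*" using step(1,2) by (rule rtrancl_into_rtrancl)
        then have "z \<noteq> v" using nv by blast
        moreover have "y \<noteq> v" using step.IH by blast
        ultimately have "{y, z} \<noteq> {u, v}" by (simp add: doubleton_eq_iff)
        then have "(y, z) \<in> adj (F - {{u, v}})" using step.hyps(2) by (simp add: adj_def)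
        then show ?case using step.IH \<open>z \<noteq> v\<close> rtrancl_into_rtrancl[of v y _ z] by blast
      qed
      then have "C v x \<subseteq> C u v" "v \<notin> C v x" unfolding C_def by blast+
      moreover have "v \<in> C u v" by (simp add: C_def)
      ultimately have "card (C v x) < card (C u v)" using fin by (intro psubset_card_mono) auto
      then show ?thesis using less.hyps f(1) x by blast
    qed (use less.prems in blast)
  qed
  moreover obtain u v where "{u, v} \<in> F" "u \<noteq> v"
    using \<open>F \<noteq> {}\<close> two by (metis card_2_iff ex_in_conv)
  ultimately show ?thesis by blast
qed

text \<open>Edge-disjoint connections between distinct vertices would close a cycle. For a component
  and the placed part of the tree this means that they share at most one vertex.\<close>

lemma forest_connections_disjoint:
  assumes "forest T" "finite K" "K \<subseteq> T" "P \<subseteq> T" "K \<inter> P = {}" and two: "\<And>e. e \<in> T \<Longrightarrow> card e = 2"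
    and K: "(x, y) \<in> (adj K)\<^sup>*" and P: "(x, y) \<in> (adj P)\<^sup>*"
  shows "x = y"
  using \<open>finite K\<close> \<open>K \<subseteq> T\<close> \<open>K \<inter> P = {}\<close> K
proof (induction K rule: finite_psubset_induct)
  case (psubset K)
  show ?case
  proof (rule ccontr)
    assume "x \<noteq> y"
    then have "(x, y) \<in> (adj K)\<^sup>+" using psubset.prems(3) by (simp add: rtrancl_eq_or_trancl)
    then have "K \<noteq> {}" by (auto simp: adj_def)
    then obtain e where e: "e \<in> K" by blast
    \<comment> \<open>By the induction hypothesis every connection within \<open>K\<close> uses
      \<open>e\<close>; combined with the connection in \<open>P\<close> it joins the ends of
      \<open>e\<close> in \<open>T - {e}\<close>.\<close>
    have no: "(x, y) \<notin> (adj (K - {e}))\<^sup>*"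
      using psubset.IH[of "K - {e}"] psubset.prems e \<open>x \<noteq> y\<close> by blast
    obtain u v where uv: "e = {u, v}" "u \<noteq> v" using two e psubset.prems(1) by (metis card_2_iff subsetD)
    let ?R = "(adj (K - {e}))\<^sup>*"
    have "(x, z) \<in> ?R \<or> (x, u) \<in> ?R \<and> (v, z) \<in> ?R \<or> (x, v) \<in> ?R \<and> (u, z) \<in> ?R"
      if "(x, z) \<in> (adj K)\<^sup>*" for z
      using that
    proof (induction rule: rtrancl_induct)
      case (step z t)
      show ?case
      proof (cases "{z, t} = e")
        case True
        then have "z = u \<and> t = v \<or> z = v \<and> t = u" using uv by (auto simp: doubleton_eq_iff)
        then show ?thesis using step.IH adj_sym rtrancl_trans by blast
      next
        case False
        then have "(z, t) \<in> adj (K - {e})" using step.hyps(2) by (auto simp: adj_def)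
        then show ?thesis using step.IH rtrancl_into_rtrancl by meson
      qed
    qed blast
    then have "(x, u) \<in> ?R \<and> (v, y) \<in> ?R \<or> (x, v) \<in> ?R \<and> (u, y) \<in> ?R"
      using psubset.prems(3) no by blast
    moreover have "?R \<subseteq> (adj (T - {e}))\<^sup>*" using psubset.prems(1) by (intro adj_mono) auto
    moreover have "(x, y) \<in> (adj (T - {e}))\<^sup>*"
      using P adj_mono[of P "T - {e}"] \<open>P \<subseteq> T\<close> psubset.prems(2) e by blast
    ultimately have "(u, v) \<in> (adj (T - {e}))\<^sup>*" using adj_sym rtrancl_trans by (smt (verit) subsetD)
    then show False using \<open>forest T\<close> uv e psubset.prems(1) unfolding forest_def by blast
  qed
qed


text \<open>A repeated vertex on a shortest walk would allow a shortcut.\<close>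

lemma relpow_shortest_inj:
  assumes n: "(x, y) \<in> R ^^ n" and min: "\<And>m. (x, y) \<in> R ^^ m \<Longrightarrow> n \<le> m"
  shows "\<exists>f. f 0 = x \<and> f n = y \<and> (\<forall>i<n. (f i, f (Suc i)) \<in> R) \<and> inj_on f {..n}"
proof -
  obtain f where f: "f 0 = x" "f n = y" "\<And>i. i < n \<Longrightarrow> (f i, f (Suc i)) \<in> R"
    using n unfolding relpow_fun_conv by blast
  have sub: "(f i, f (i + k)) \<in> R ^^ k" if "i + k \<le> n" for i k
    using that
  proof (induction k)
    case (Suc k)
    then have "(f i, f (i + k)) \<in> R ^^ k" "(f (i + k), f (i + Suc k)) \<in> R" using f(3)[of "i + k"] by simp_all
    then show ?case by auto
  qed simp
  have "f i \<noteq> f j" if "i < j" "j \<le> n" for i j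
  proof
    assume eq: "f i = f j"
    have "(x, f i) \<in> R ^^ i" using sub[of 0 i] that f(1) by simp
    moreover have "(f j, y) \<in> R ^^ (n - j)" using sub[of j "n - j"] that f(2) by simp
    ultimately have "(x, y) \<in> R ^^ (i + (n - j))" unfolding relpow_add eq by blast
    then show False using min[of "i + (n - j)"] that by simp
  qed
  then have "inj_on f {..n}" by (intro linorder_inj_onI) auto
  then show ?thesis using f by blast
qed

text \<open>If an edge is no bridge, a shortest walk around it is injective and closes up with the
  edge to a cycle; the walk has at least two steps because the edge itself has been removed.\<close>

lemma tree_graph_forest:
  assumes "tree_graph V E"
  shows "forest E"
  unfolding forest_def
proof (intro allI impI notI)
  fix u v assume e: "{u, v} \<in> E" "u \<noteq> v" and path: "(u, v) \<in> (adj (E - {{u, v}}))\<^sup>*"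
  let ?R = "adj (E - {{u, v}})"
  define n where "n = (LEAST n. (u, v) \<in> ?R ^^ n)"
  have ex: "\<exists>n. (u, v) \<in> ?R ^^ n" using path by (simp add: rtrancl_power)
  have "(u, v) \<in> ?R ^^ n" unfolding n_def using ex by (rule LeastI_ex)
  moreover have "n \<le> m" if "(u, v) \<in> ?R ^^ m" for m unfolding n_def using that by (rule Least_le)
  ultimately obtain f where f: "f 0 = u" "f n = v" "\<And>i. i < n \<Longrightarrow> (f i, f (Suc i)) \<in> ?R" "inj_on f {..n}"
    using relpow_shortest_inj by metis
  have "n \<noteq> 0" using f(1,2) e(2) by (metis)
  moreover have "n \<noteq> 1" using f(1,2) f(3)[of 0] by (auto simp: adj_def)
  ultimately have "n \<ge> 2" by linarith
  define p where "p = map f [0..<Suc n]"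
  have "distinct p" using f(4) by (simp only: p_def distinct_map distinct_upt) (simp add: atLeast0_lessThan_Suc_eq_insert_0 inj_on_def atMost_def less_Suc_eq_le)
  moreover have "3 \<le> length p" using \<open>n \<ge> 2\<close> by (simp add: p_def)
  moreover have "{p ! i, p ! (Suc i mod length p)} \<in> E" if "i < length p" for i
  proof (cases "i = n")
    case True
    then have "p ! i = v" "p ! (Suc i mod length p) = u" using f(1,2) by (simp_all add: p_def del: upt_Suc)
    then show ?thesis using e(1) by (simp add: insert_commute)
  next
    case False
    then have "i < n" using that by (simp add: p_def)
    then have "p ! i = f i" "p ! (Suc i mod length p) = f (Suc i)" by (simp_all add: p_def del: upt_Suc)
    then show ?thesis using f(3)[OF \<open>i < n\<close>] by (simp add: adj_def)
  qed
  ultimately have "graph_cycle E p" by (simp add: graph_cycle_def)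
  then show False using assms by (auto simp: tree_graph_def)
qed

subsection \<open>Planar drawings\<close>

definition map_drawing :: "(complex \<Rightarrow> complex) \<Rightarrow> 'v drawing \<Rightarrow> 'v drawing" where
  "map_drawing h \<Gamma> = \<lparr>vpos = h \<circ> vpos \<Gamma>, ecurve = (\<lambda>e. h ` ecurve \<Gamma> e)\<rparr>"

lemma map_drawing_simps [simp]:
  "vpos (map_drawing h \<Gamma>) v = h (vpos \<Gamma> v)" "ecurve (map_drawing h \<Gamma>) e = h ` ecurve \<Gamma> e"
  by (simp_all add: map_drawing_def)

lemma drawing_arc_ex:
  "is_drawing V E \<Gamma> \<Longrightarrow> e \<in> E \<Longrightarrow>
    \<exists>g. arc g \<and> path_image g = ecurve \<Gamma> e \<and> {pathstart g, pathfinish g} = vpos \<Gamma> ` e"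
  by (simp add: is_drawing_def)

lemma planar_drawing_map:
  assumes h: "plane_embedding h" and "planar_drawing V E \<Gamma>"
  shows "planar_drawing V E (map_drawing h \<Gamma>)"
proof -
  have inj: "h x = h y \<longleftrightarrow> x = y" for x y using h by (auto simp: plane_embedding_def inj_on_def)
  have "\<exists>g. arc g \<and> path_image g = h ` ecurve \<Gamma> e \<and> {pathstart g, pathfinish g} = (\<lambda>v. h (vpos \<Gamma> v)) ` e"
    if eE: "e \<in> E" for e
  proof -
    obtain g where g: "arc g" "path_image g = ecurve \<Gamma> e" "{pathstart g, pathfinish g} = vpos \<Gamma> ` e"
      using drawing_arc_ex[OF _ eE] assms(2) unfolding planar_drawing_def by blast
    have "continuous_on (path_image g) h"
      using h continuous_on_subset[of UNIV h] by (simp add: plane_embedding_def)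
    then have "path (h \<circ> g)" using g(1) by (intro path_continuous_image arc_imp_path)
    moreover have "inj_on (h \<circ> g) {0..1}" using g(1) by (auto simp: arc_def inj_on_def inj)
    ultimately have "arc (h \<circ> g)" by (simp add: arc_def)
    moreover have "path_image (h \<circ> g) = h ` ecurve \<Gamma> e" using g(2) by (simp add: path_image_compose)
    moreover have "{pathstart (h \<circ> g), pathfinish (h \<circ> g)} = h ` (vpos \<Gamma> ` e)"
      unfolding g(3)[symmetric] by (simp add: pathstart_compose pathfinish_compose)
    ultimately show ?thesis by (metis image_image)
  qed
  moreover have "edge_interior (map_drawing h \<Gamma>) e = h ` edge_interior \<Gamma> e" for e
    by (auto simp: edge_interior_def inj)
  moreover have "inj_on (vpos (map_drawing h \<Gamma>)) V"
    using assms(2) by (simp add: planar_drawing_def is_drawing_def inj_on_def inj)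
  moreover have "h x \<in> h ` A \<longleftrightarrow> x \<in> A" for x A
    using h by (simp add: plane_embedding_def inj_image_mem_iff)
  moreover have "h ` A \<inter> h ` B = {} \<longleftrightarrow> A \<inter> B = {}" for A B
    using h image_Int[of h A B] by (auto simp: plane_embedding_def)
  ultimately show ?thesis using assms(2)
    by (simp add: planar_drawing_def is_drawing_def edges_cross_def)
qed

lemma edge_cases:
  assumes "simple_graph V E" "e \<in> E" "v \<in> e"
  obtains u where "e = {v, u}" "u \<noteq> v" "u \<in> V" "v \<in> V"
proof -
  have "card e = 2" "e \<subseteq> V" using assms by (auto simp: simple_graph_def)
  then obtain x y where "e = {x, y}" "x \<noteq> y" by (auto simp: card_2_iff)
  then show thesis using that[of x] that[of y] assms(3) \<open>e \<subseteq> V\<close> by (auto simp: insert_commute)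
qed

lemma finite_edges: "simple_graph V E \<Longrightarrow> finite E"
  unfolding simple_graph_def by (rule finite_subset[of E "Pow V"]) auto

lemma drawing_arc:
  assumes "simple_graph V E" "is_drawing V E \<Gamma>" "{u, v} \<in> E" "u \<noteq> v"
  obtains g where "arc g" "path_image g = ecurve \<Gamma> {u, v}" "pathstart g = vpos \<Gamma> u" "pathfinish g = vpos \<Gamma> v"
proof -
  obtain g where g: "arc g" "path_image g = ecurve \<Gamma> {u, v}" "{pathstart g, pathfinish g} = {vpos \<Gamma> u, vpos \<Gamma> v}"
    using drawing_arc_ex[OF assms(2,3)] by auto
  consider "pathstart g = vpos \<Gamma> u" "pathfinish g = vpos \<Gamma> v" | "pathstart g = vpos \<Gamma> v" "pathfinish g = vpos \<Gamma> u"
    using g(3) by (auto simp: doubleton_eq_iff)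
  then show thesis
  proof cases
    case 1 then show thesis using that g by blast
  next
    case 2 then show thesis using that[of "reversepath g"] g by (simp add: arc_reversepath)
  qed
qed

lemma drawing_curve:
  assumes "is_drawing V E \<Gamma>" "e \<in> E"
  shows "compact (ecurve \<Gamma> e)" "connected (ecurve \<Gamma> e)" "connected (- ecurve \<Gamma> e)"
    "vpos \<Gamma> ` e \<subseteq> ecurve \<Gamma> e"
proof -
  obtain g where g: "arc g" "path_image g = ecurve \<Gamma> e" "{pathstart g, pathfinish g} = vpos \<Gamma> ` e"
    using drawing_arc_ex[OF assms] by blast
  show "compact (ecurve \<Gamma> e)" "connected (ecurve \<Gamma> e)"
    unfolding g(2)[symmetric] using arc_imp_path[OF g(1)]
    by (simp_all add: compact_path_image connected_path_image)
  show "connected (- ecurve \<Gamma> e)" using connected_arc_complement[OF g(1)] g(2) by simp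
  show "vpos \<Gamma> ` e \<subseteq> ecurve \<Gamma> e"
    unfolding g(2)[symmetric] g(3)[symmetric]
    by (simp add: pathstart_in_path_image pathfinish_in_path_image)
qed

lemma drawing_vertex_on_curve:
  "is_drawing V E \<Gamma> \<Longrightarrow> e \<in> E \<Longrightarrow> v \<in> V \<Longrightarrow> vpos \<Gamma> v \<in> ecurve \<Gamma> e \<Longrightarrow> v \<in> e"
  by (auto simp: is_drawing_def)

text \<open>A common point is not interior to both curves, so it is a vertex, and a vertex lies only
  on curves of incident edges.\<close>

lemma planar_curves_meet:
  assumes "simple_graph V E" "planar_drawing V E \<Gamma>" "e \<in> E" "f \<in> E" "e \<noteq> f"
    and z: "z \<in> ecurve \<Gamma> e" "z \<in> ecurve \<Gamma> f"
  shows "z \<in> vpos \<Gamma> ` (e \<inter> f)"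
proof -
  have d: "is_drawing V E \<Gamma>" "edge_interior \<Gamma> e \<inter> edge_interior \<Gamma> f = {}"
    using assms by (auto simp: planar_drawing_def edges_cross_def)
  have V: "e \<subseteq> V" "f \<subseteq> V" using assms by (auto simp: simple_graph_def)
  have "z \<in> vpos \<Gamma> ` e \<or> z \<in> vpos \<Gamma> ` f" using d(2) z by (auto simp: edge_interior_def)
  then obtain v where v: "z = vpos \<Gamma> v" "v \<in> V" using V by blast
  then have "v \<in> e \<inter> f" using drawing_vertex_on_curve[OF d(1)] assms(3,4) z by blast
  then show ?thesis using v by blast
qed

lemma planar_drawingI:
  assumes "is_drawing V E \<Gamma>"
    and "\<And>e f z. e \<in> E \<Longrightarrow> f \<in> E \<Longrightarrow> e \<noteq> f \<Longrightarrow> z \<in> ecurve \<Gamma> e \<Longrightarrow> z \<in> ecurve \<Gamma> f \<Longrightarrow> z \<in> vpos \<Gamma> ` (e \<inter> f)"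
  shows "planar_drawing V E \<Gamma>"
  using assms unfolding planar_drawing_def edges_cross_def edge_interior_def by blast

text \<open>The arc of a leaf edge \<open>{u, v}\<close> meets the remaining curves at most in the
  position of \<open>u\<close>. Janiszewski's theorem then passes connectedness of the two
  complements on to the complement of the union.\<close>

lemma forest_complement_connected:
  assumes G: "simple_graph V E" "planar_drawing V E \<Gamma>" and "F \<subseteq> E" "forest F"
  shows "connected (- (\<Union>e\<in>F. ecurve \<Gamma> e))"
proof -
  have D: "is_drawing V E \<Gamma>" using G(2) by (simp add: planar_drawing_def)
  have "finite F" using finite_edges[OF G(1)] \<open>F \<subseteq> E\<close> finite_subset by blast
  then show ?thesis using \<open>F \<subseteq> E\<close> \<open>forest F\<close>
  proof (induction F rule: finite_psubset_induct)
    case (psubset F)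
    show ?case
    proof (cases "F = {}")
      case False
      have "card e = 2" if "e \<in> F" for e using that psubset.prems(1) G(1) by (auto simp: simple_graph_def)
      then obtain u v where uv: "{u, v} \<in> F" "u \<noteq> v" "v \<notin> \<Union> (F - {{u, v}})"
        using forest_leaf[of F] psubset.hyps psubset.prems(2) False by blast
      let ?e = "{u, v}" and ?S = "\<Union>e\<in>F - {{u, v}}. ecurve \<Gamma> e"
      have eE: "?e \<in> E" using uv(1) psubset.prems(1) by blast
      have "connected (- ?S)"
        using psubset.IH[of "F - {?e}"] uv(1) psubset.prems forest_subset[of F "F - {?e}"] by blast
      moreover have "compact (ecurve \<Gamma> f)" if "f \<in> F - {?e}" for f
        using that psubset.prems(1) drawing_curve(1)[OF D] by blast
      then have "compact ?S" using psubset.hyps by (intro compact_UN) auto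
      then have "closed ?S" by (rule compact_imp_closed)
      moreover have "ecurve \<Gamma> ?e \<inter> ?S \<subseteq> {vpos \<Gamma> u}"
      proof
        fix z assume "z \<in> ecurve \<Gamma> ?e \<inter> ?S"
        then obtain f where f: "f \<in> F" "f \<noteq> ?e" "z \<in> ecurve \<Gamma> ?e" "z \<in> ecurve \<Gamma> f" by blast
        then have "z \<in> vpos \<Gamma> ` (?e \<inter> f)"
          using planar_curves_meet[OF G eE, of f z] psubset.prems(1) by blast
        moreover have "v \<notin> f" using uv(3) f(1,2) by blast
        ultimately show "z \<in> {vpos \<Gamma> u}" by auto
      qed
      then have "connected (ecurve \<Gamma> ?e \<inter> ?S)" by (auto simp: subset_singleton_iff)
      ultimately have "connected (- (ecurve \<Gamma> ?e \<union> ?S))"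
        using Janiszewski_connected[of "ecurve \<Gamma> ?e" ?S] drawing_curve(1,3)[OF D eE] by blast
      moreover have "ecurve \<Gamma> ?e \<union> ?S = (\<Union>e\<in>F. ecurve \<Gamma> e)" using uv(1) by blast
      ultimately show ?thesis by simp
    qed (simp add: connected_UNIV)
  qed
qed

lemma component_curves_connected:
  assumes G: "simple_graph V E" and D: "is_drawing V E \<Gamma>" and "F \<subseteq> E" "w \<in> \<Union> F"
  defines "K \<equiv> {f \<in> F. \<exists>x\<in>f. (w, x) \<in> (adj F)\<^sup>*}"
  shows "connected (\<Union>e\<in>K. ecurve \<Gamma> e)"
proof -
  let ?X = "\<Union>e\<in>K. ecurve \<Gamma> e"
  have part: "connected_component ?X (vpos \<Gamma> y) z" if "f \<in> K" "y \<in> f" "z \<in> ecurve \<Gamma> f" for f y z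
  proof -
    have "f \<in> E" using that(1) \<open>F \<subseteq> E\<close> by (auto simp: K_def)
    then have "vpos \<Gamma> y \<in> ecurve \<Gamma> f" "connected (ecurve \<Gamma> f)"
      using drawing_curve(2,4)[OF D] that(2) by auto
    then show ?thesis unfolding connected_component_def using that by blast
  qed
  have reach: "connected_component ?X (vpos \<Gamma> w) (vpos \<Gamma> x)" if "(w, x) \<in> (adj F)\<^sup>*" for x
    using that
  proof (induction rule: rtrancl_induct)
    case base
    obtain f where "f \<in> F" "w \<in> f" using \<open>w \<in> \<Union> F\<close> by blast
    then have "f \<in> K" by (auto simp: K_def)
    then show ?case using part[of f w "vpos \<Gamma> w"] \<open>w \<in> f\<close> drawing_curve(4)[OF D, of f] \<open>f \<in> F\<close> \<open>F \<subseteq> E\<close> by blast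
  next
    case (step x y)
    then have K: "{x, y} \<in> K" by (auto simp: K_def adj_def)
    then have "vpos \<Gamma> y \<in> ecurve \<Gamma> {x, y}" using drawing_curve(4)[OF D, of "{x, y}"] \<open>F \<subseteq> E\<close> by (auto simp: K_def)
    then show ?case using part[OF K, of x] step.IH connected_component_trans by blast
  qed
  have "connected_component ?X (vpos \<Gamma> w) z" if zX: "z \<in> ?X" for z
  proof -
    obtain f where f: "f \<in> K" "z \<in> ecurve \<Gamma> f" using zX by blast
    then obtain y where "y \<in> f" "(w, y) \<in> (adj F)\<^sup>*" by (auto simp: K_def)
    then show ?thesis using part[OF f(1) _ f(2)] reach connected_component_trans by blast
  qed
  then show ?thesis unfolding connected_iff_connected_component
    using connected_component_sym connected_component_trans by metis
qed

text \<open>The complement of the curves of \<open>F\<close> is open and connected, and stays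
  connected when finitely many points are deleted. So finitely many points can be moved
  simultaneously by a homeomorphism supported there.\<close>

lemma move_vertices:
  assumes G: "simple_graph V E" "planar_drawing V E \<Gamma>" and F: "F \<subseteq> E" "forest F"
    and "A \<subseteq> V" "S \<subseteq> V" "S \<inter> A = {}" "S \<inter> \<Union> F = {}" and q: "inj_on q S"
    and avoid: "\<And>v. v \<in> S \<Longrightarrow> q v \<notin> (\<Union>e\<in>F. ecurve \<Gamma> e) \<union> vpos \<Gamma> ` A"
  shows "\<exists>h. plane_embedding h \<and> (\<forall>v\<in>S. h (vpos \<Gamma> v) = q v)
           \<and> (\<forall>z\<in>(\<Union>e\<in>F. ecurve \<Gamma> e) \<union> vpos \<Gamma> ` A. h z = z)"
proof -
  have D: "is_drawing V E \<Gamma>" using G(2) by (simp add: planar_drawing_def)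
  have finF: "finite F" using finite_edges[OF G(1)] F(1) finite_subset by blast
  have fin: "finite V" using G(1) by (simp add: simple_graph_def)
  let ?X = "\<Union>e\<in>F. ecurve \<Gamma> e" and ?U = "- (\<Union>e\<in>F. ecurve \<Gamma> e) - vpos \<Gamma> ` A"
  have "compact ?X" using finF F(1) drawing_curve(1)[OF D] by (intro compact_UN) auto
  then have oX: "open (- ?X)" by (intro open_Compl compact_imp_closed)
  have fA: "finite (vpos \<Gamma> ` A)" using fin \<open>A \<subseteq> V\<close> finite_subset by blast
  have cU: "connected ?U"
    using connected_open_delete_finite[OF oX forest_complement_connected[OF G F] _ fA] by simp
  have oU: "open ?U" using oX fA by (intro open_Diff finite_imp_closed)
  have inU: "vpos \<Gamma> v \<in> ?U \<and> q v \<in> ?U" if "v \<in> S" for v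
  proof -
    have "v \<in> V" using that \<open>S \<subseteq> V\<close> by blast
    have "vpos \<Gamma> v \<notin> ?X"
      using that \<open>v \<in> V\<close> drawing_vertex_on_curve[OF D] F(1) \<open>S \<inter> \<Union> F = {}\<close> by blast
    moreover have "vpos \<Gamma> v \<notin> vpos \<Gamma> ` A"
      using D \<open>v \<in> V\<close> \<open>A \<subseteq> V\<close> that \<open>S \<inter> A = {}\<close> by (auto simp: is_drawing_def inj_on_def)
    ultimately show ?thesis using avoid[OF that] by blast
  qed
  have pw: "pairwise (\<lambda>i j. vpos \<Gamma> i \<noteq> vpos \<Gamma> j \<and> q i \<noteq> q j) S"
    using inj_on_subset[of "vpos \<Gamma>" V S] D q \<open>S \<subseteq> V\<close>
    by (auto simp: pairwise_def is_drawing_def dest: inj_onD)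
  have finS: "finite S" using fin \<open>S \<subseteq> V\<close> finite_subset by blast
  \<comment> \<open>A nonempty open region has the whole plane as its affine hull, which the theorem
    on moving points asks for.\<close>
  have "bounded (?X \<union> vpos \<Gamma> ` A)"
    using \<open>compact ?X\<close> fA by (simp add: compact_imp_bounded finite_imp_bounded del: UN_simps)
  then have "?X \<union> vpos \<Gamma> ` A \<noteq> UNIV" using not_bounded_UNIV by metis
  then have "?U \<noteq> {}" by blast
  then have hull: "UNIV \<subseteq> affine hull ?U" using affine_hull_open[OF oU] by simp
  obtain h k where hk: "homeomorphism UNIV UNIV h k" "\<And>v. v \<in> S \<Longrightarrow> h (vpos \<Gamma> v) = q v"
    "{x. \<not> (h x = x \<and> k x = x)} \<subseteq> ?U"
    by (rule homeomorphism_moving_points_exists[OF _ oU cU subset_UNIV finS inU pw subset_UNIV hull cU]) simp_all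
  have "plane_embedding h"
    using hk(1) inj_on_inverseI[of UNIV k h] by (simp add: plane_embedding_def homeomorphism_def)
  then show ?thesis using hk(2,3) by blast
qed


section \<open>Redrawing edges radially near their end vertices\<close>

lemma shorten_arc:
  fixes g :: "real \<Rightarrow> complex"
  assumes g: "arc g" "pathstart g = w" and r: "r > 0" "dist w (pathfinish g) > r"
  shows "\<exists>a k. dist w a = r \<and> arc k \<and> pathstart k = a \<and> pathfinish k = pathfinish g
           \<and> path_image k \<subseteq> path_image g \<and> path_image k \<inter> cball w r = {a}"
proof -
  have contg: "continuous_on {0..1} g" using arc_imp_path[OF g(1)] by (simp add: path_def)
  then have cont: "continuous_on {0..1} (\<lambda>t. dist w (g t))" by (intro continuous_intros)
  define T where "T = {t \<in> {0..1}. dist w (g t) \<le> r}"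
  have "closed T" unfolding T_def
    using continuous_closed_preimage[OF cont, of "{..r}"] by (simp add: vimage_def Int_def)
  moreover have "bounded T" unfolding T_def by (rule bounded_subset[of "{0..1}"]) auto
  ultimately have "compact T" by (simp add: compact_eq_bounded_closed)
  moreover have "0 \<in> T" using g(2) r(1) by (auto simp: T_def pathstart_def)
  then have "T \<noteq> {}" by blast
  \<comment> \<open>\<open>s\<close> is the last parameter in the closed disc, so the arc never
    returns after it; the intermediate value theorem then places \<open>g s\<close> exactly on the
    circle.\<close>
  ultimately obtain s where s: "s \<in> T" "\<And>t. t \<in> T \<Longrightarrow> t \<le> s" using compact_attains_sup[of T] by auto
  have s01: "0 \<le> s" "s \<le> 1" "dist w (g s) \<le> r" using s(1) by (auto simp: T_def)
  have g1: "r \<le> dist w (g 1)" using r(2) by (simp add: pathfinish_def)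
  have "continuous_on {s..1} (\<lambda>t. dist w (g t))" using cont continuous_on_subset s01 by fastforce
  then obtain t where t: "s \<le> t" "t \<le> 1" "dist w (g t) = r"
    using IVT'[of "\<lambda>t. dist w (g t)" s r 1] s01 g1 by blast
  then have "t \<in> T" using s01 by (auto simp: T_def)
  then have eq: "dist w (g s) = r" using s(2) t by (metis antisym)
  have "s \<noteq> 1" using eq r(2) by (auto simp: pathfinish_def)
  let ?k = "subpath s 1 g"
  have im: "path_image ?k = g ` {s..1}" using s01 by (simp add: path_image_subpath)
  show ?thesis
  proof (intro exI conjI)
    show "dist w (g s) = r" by fact
    show "arc ?k" using arc_subpath_arc[OF g(1)] s01 \<open>s \<noteq> 1\<close> by simp
    show "pathstart ?k = g s" "pathfinish ?k = pathfinish g" by (simp_all add: pathstart_def pathfinish_def subpath_def)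
    show "path_image ?k \<subseteq> path_image g" unfolding im using s01 by (auto simp: path_image_def)
    have last: "t = s" if "t \<in> {s..1}" "g t \<in> cball w r" for t
    proof -
      have "t \<in> T" using that s01 by (auto simp: T_def)
      then show ?thesis using s(2)[of t] that(1) by auto
    qed
    have "g s \<in> g ` {s..1} \<inter> cball w r" using eq s01 by simp
    then show "path_image ?k \<inter> cball w r = {g s}" unfolding im using last by blast
  qed
qed

lemma unit_direction_avoiding:
  assumes "finite D"
  shows "\<exists>d::complex. norm d = 1 \<and> d \<notin> D"
proof -
  have "infinite (sphere (0::complex) 1)"
  proof
    assume "finite (sphere (0::complex) 1)"
    then obtain a where a: "sphere (0::complex) 1 \<subseteq> {a}"
      using connected_finite_iff_sing[OF connected_sphere[of "0::complex" 1]] by auto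
    have "(1::complex) \<in> sphere 0 1" "(- 1::complex) \<in> sphere 0 1" by auto
    then have "(1::complex) = -1" using a by blast
    then show False by simp
  qed
  then have "\<not> sphere (0::complex) 1 \<subseteq> D" using assms finite_subset by blast
  then show ?thesis by auto
qed

lemma free_at_local:
  assumes "free_at X v" "r > 0" "Y \<inter> ball v r \<subseteq> X"
  shows "free_at Y v"
proof -
  obtain d e where de: "norm d = 1" "e > 0"
    "\<And>z. z \<in> X \<Longrightarrow> z \<noteq> v \<Longrightarrow> dist z v < e \<Longrightarrow> e \<le> norm (sgn (z - v) - d)"
    using assms(1) unfolding free_at_def by blast
  have "min e r \<le> norm (sgn (z - v) - d)" if "z \<in> Y" "z \<noteq> v" "dist z v < min e r" for z
  proof -
    have "z \<in> X" using that assms(3) by (auto simp: dist_commute)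
    then show ?thesis using de(3)[of z] that by simp
  qed
  then show ?thesis unfolding free_at_def using de(1,2) assms(2) by (intro exI[of _ d] exI[of _ "min e r"]) auto
qed

text \<open>A free sector has room for two directions: \<open>K\<close> goes into a narrow sector
  about \<open>d\<close>, and a direction \<open>d'\<close> at distance \<open>e / 2\<close> from
  \<open>d\<close> stays free of \<open>X\<close> and of \<open>K\<close>. So further sets can be
  attached at \<open>w\<close> later.\<close>

lemma free_at_attach:
  assumes "free_at X w"
  obtains d e where "norm d = 1" "e > 0" "X \<inter> thin_sector w d e = {}"
    "\<And>K. K - {w} \<subseteq> thin_sector w d e \<Longrightarrow> free_at (X \<union> K) w"
proof -
  obtain d e0 where de0: "norm d = 1" "e0 > 0"
    "\<And>z. z \<in> X \<Longrightarrow> z \<noteq> w \<Longrightarrow> dist z w < e0 \<Longrightarrow> e0 \<le> norm (sgn (z - w) - d)"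
    using assms unfolding free_at_def by blast
  define e where "e = min e0 1"
  have e: "0 < e" "e \<le> 1" using de0(2) by (auto simp: e_def)
  have far: "e \<le> norm (sgn (z - w) - d)" if "z \<in> X" "z \<noteq> w" "dist z w < e" for z
    using de0(3)[of z] that by (simp add: e_def)
  \<comment> \<open>On the connected unit circle the distance to \<open>d\<close> takes the values 0
    and 2, hence also \<open>e / 2\<close>.\<close>
  have "connected ((\<lambda>x. norm (x - d)) ` sphere 0 1)"
    by (intro connected_continuous_image continuous_intros connected_sphere) simp
  moreover have "0 \<in> (\<lambda>x. norm (x - d)) ` sphere 0 1" using de0(1) by (auto simp: image_iff intro: bexI[of _ d])
  moreover have "norm (- d - d) = 2"
  proof -
    have "- d - d = (- 2) * d" by simp
    then show ?thesis using de0(1) by (simp only: norm_mult) simp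
  qed
  then have "2 \<in> (\<lambda>x. norm (x - d)) ` sphere 0 1" using de0(1) by (auto simp: image_iff intro: bexI[of _ "- d"])
  moreover have "0 \<le> e / 2" "e / 2 \<le> 2" using e by auto
  ultimately have "e / 2 \<in> (\<lambda>x. norm (x - d)) ` sphere 0 1"
    unfolding connected_iff_interval by blast
  then obtain d' where d': "norm d' = 1" "norm (d' - d) = e / 2" by auto
  show thesis
  proof (rule that)
    show "norm d = 1" by fact
    show "e / 4 > 0" using e by simp
    show "X \<inter> thin_sector w d (e / 4) = {}" using far e unfolding thin_sector_def by fastforce
    fix K assume K: "K - {w} \<subseteq> thin_sector w d (e / 4)"
    have "e / 4 \<le> norm (sgn (z - w) - d')" if z: "z \<in> X \<union> K" "z \<noteq> w" "dist z w < e / 4" for z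
    proof -
      have tri: "norm (d' - d) \<le> norm (sgn (z - w) - d) + norm (sgn (z - w) - d')"
        "norm (sgn (z - w) - d) \<le> norm (sgn (z - w) - d') + norm (d' - d)"
        using norm_triangle_ineq4[of "sgn (z - w) - d" "sgn (z - w) - d'"]
          norm_triangle_ineq[of "sgn (z - w) - d'" "d' - d"] by simp_all
      show ?thesis
      proof (cases "z \<in> X")
        case True
        then show ?thesis using far[of z] z e tri(2) d'(2) by simp
      next
        case False
        then have "norm (sgn (z - w) - d) < e / 4" using K z unfolding thin_sector_def by blast
        then show ?thesis using tri(1) d'(2) by simp
      qed
    qed
    then show "free_at (X \<union> K) w"
      unfolding free_at_def using d'(1) e by (intro exI[of _ d'] exI[of _ "e / 4"]) auto
  qed
qed

lemma open_thin_sector: "open (thin_sector w d e)"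
proof -
  have "thin_sector w d e = (- {w} \<inter> ball w e) \<inter> (\<lambda>z. norm (sgn (z - w) - d)) -` {..<e}"
    by (auto simp: thin_sector_def dist_commute)
  moreover have "continuous_on (- {w} \<inter> ball w e) (\<lambda>z. norm (sgn (z - w) - d))"
    by (intro continuous_intros) auto
  ultimately show ?thesis
    using continuous_open_preimage[of "- {w} \<inter> ball w e" "\<lambda>z. norm (sgn (z - w) - d)" "{..<e}"]
    by (metis open_Compl closed_singleton open_ball open_Int open_lessThan)
qed

text \<open>An arc may wind around its end vertex and leave no direction free. Each edge at
  \<open>w\<close> is cut at its last point on a small circle about \<open>w\<close> and continued
  to \<open>w\<close> by a radius; finitely many radii leave a free direction.\<close>

lemma tame_at:
  assumes G: "simple_graph V E" "planar_drawing V E \<Gamma>" and "w \<in> V" "\<epsilon> > 0"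
  shows "\<exists>\<Gamma>'. planar_drawing V E \<Gamma>' \<and> vpos \<Gamma>' = vpos \<Gamma>
    \<and> (\<forall>e. w \<notin> e \<longrightarrow> ecurve \<Gamma>' e = ecurve \<Gamma> e)
    \<and> (\<forall>e\<in>E. ecurve \<Gamma>' e \<subseteq> ecurve \<Gamma> e \<union> ball (vpos \<Gamma> w) \<epsilon>)
    \<and> free_at (\<Union>e\<in>E. ecurve \<Gamma>' e) (vpos \<Gamma> w)"
proof -
  let ?p = "vpos \<Gamma>" and ?w = "vpos \<Gamma> w"
  have D: "is_drawing V E \<Gamma>" using G(2) by (simp add: planar_drawing_def)
  have inj: "inj_on ?p V" using D by (simp add: is_drawing_def)
  have fin: "finite V" "finite E" using G(1) finite_edges by (auto simp: simple_graph_def)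
  \<comment> \<open>\<open>Y\<close> gathers all vertices and edges not incident with
    \<open>w\<close>; the circle is chosen smaller than the distance from \<open>w\<close> to
    \<open>Y\<close>.\<close>
  define Y where "Y = ?p ` (V - {w}) \<union> (\<Union>e\<in>{e \<in> E. w \<notin> e}. ecurve \<Gamma> e)"
  have "compact (\<Union>e\<in>{e \<in> E. w \<notin> e}. ecurve \<Gamma> e)"
    using fin(2) drawing_curve(1)[OF D] by (intro compact_UN) auto
  then have "closed Y" unfolding Y_def using fin(1)
    by (intro closed_Un compact_imp_closed finite_imp_closed) (simp_all del: UN_simps)
  moreover have "?w \<notin> Y"
  proof
    assume "?w \<in> Y"
    then consider v where "v \<in> V - {w}" "?w = ?p v" | e where "e \<in> E" "w \<notin> e" "?w \<in> ecurve \<Gamma> e"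
      unfolding Y_def by blast
    then show False
      using drawing_vertex_on_curve[OF D _ \<open>w \<in> V\<close>] inj_onD[OF inj _ \<open>w \<in> V\<close>] by cases blast+
  qed
  ultimately obtain \<rho> where \<rho>: "\<rho> > 0" "\<And>y. y \<in> Y \<Longrightarrow> \<rho> \<le> dist ?w y"
    using separate_point_closed[of Y ?w] by auto
  define r where "r = min (\<rho> / 2) (\<epsilon> / 2)"
  have r: "r > 0" "r < \<rho>" "r < \<epsilon>" using \<rho>(1) \<open>\<epsilon> > 0\<close> by (auto simp: r_def)
  have rY: "dist ?w y > r" if "y \<in> Y" for y using \<rho>(2)[OF that] r(2) by linarith
  have "\<exists>a k. dist ?w a = r \<and> arc k \<and> pathstart k = a \<and> {?w, pathfinish k} = ?p ` e
           \<and> path_image k \<subseteq> ecurve \<Gamma> e \<and> path_image k \<inter> cball ?w r = {a}" if e: "e \<in> E" "w \<in> e" for e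
  proof -
    obtain u where u: "e = {w, u}" "u \<noteq> w" "u \<in> V" using edge_cases[OF G(1) e] by metis
    obtain g where g: "arc g" "path_image g = ecurve \<Gamma> e" "pathstart g = ?w" "pathfinish g = ?p u"
      using drawing_arc[OF G(1) D] e(1) u by metis
    have "dist ?w (pathfinish g) > r" using rY[of "?p u"] u(2,3) unfolding g(4) Y_def by blast
    then obtain a k where "dist ?w a = r" "arc k" "pathstart k = a" "pathfinish k = ?p u"
      "path_image k \<subseteq> ecurve \<Gamma> e" "path_image k \<inter> cball ?w r = {a}"
      using shorten_arc[OF g(1,3) r(1)] unfolding g(2,4) by blast
    then show ?thesis using u(1) by (intro exI[of _ a] exI[of _ k]) auto
  qed
  then obtain a k where ak: "\<And>e. e \<in> E \<Longrightarrow> w \<in> e \<Longrightarrow> dist ?w (a e) = r \<and> arc (k e) \<and> pathstart (k e) = a e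
      \<and> {?w, pathfinish (k e)} = ?p ` e
      \<and> path_image (k e) \<subseteq> ecurve \<Gamma> e \<and> path_image (k e) \<inter> cball ?w r = {a e}"
    by metis
  have aw: "a e \<noteq> ?w" if "e \<in> E" "w \<in> e" for e using ak[OF that] r(1) by auto
  have ain: "a e \<in> path_image (k e)" if "e \<in> E" "w \<in> e" for e using ak[OF that] by blast
  have seg: "closed_segment ?w (a e) \<subseteq> cball ?w r" if "e \<in> E" "w \<in> e" for e
    using ak[OF that] r(1) by (intro closed_segment_subset) auto
  \<comment> \<open>A point of two different edges is the position of a common vertex; if it is not
    \<open>w\<close>, it lies in \<open>Y\<close> and thus off the circle. Hence different edges use
    different radii.\<close>
  have a_inj: "e = f" if e: "e \<in> E" "w \<in> e" and f: "f \<in> E" "w \<in> f" and eq: "a e = a f" for e f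
  proof (rule ccontr)
    assume "e \<noteq> f"
    have "a e \<in> ecurve \<Gamma> e" "a e \<in> ecurve \<Gamma> f" using ak[OF e] ak[OF f] eq by auto
    then obtain v where v: "v \<in> e" "v \<in> f" "a e = ?p v"
      using planar_curves_meet[OF G e(1) f(1) \<open>e \<noteq> f\<close>] by blast
    have "v \<noteq> w" using v(3) aw[OF e] by auto
    then have "a e \<in> Y" using v G(1) e(1) unfolding Y_def simple_graph_def by blast
    then show False using rY ak[OF e] by fastforce
  qed
  \<comment> \<open>A radius touches the circle only at its outer end.\<close>
  have seg_eq: "e = f \<and> z = a e" if e: "e \<in> E" "w \<in> e" and f: "f \<in> E" "w \<in> f"
    and z: "z \<in> closed_segment ?w (a e)" "z = a f" for e f z
  proof -
    obtain s where s: "0 \<le> s" "s \<le> 1" "z = (1 - s) *\<^sub>R ?w + s *\<^sub>R a e" using z(1) by (auto simp: in_segment)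
    have "dist ?w z = s * r" using s(1) ak[OF e] unfolding s(3)
      by (simp add: dist_norm algebra_simps norm_minus_commute flip: scaleR_diff_right)
    moreover have "dist ?w z = r" using ak[OF f] z(2) by simp
    ultimately have "s = 1" using r(1) by simp
    then show ?thesis using s(3) z(2) a_inj[OF e f] by simp
  qed
  define C where "C e = (if w \<in> e \<and> e \<in> E then closed_segment ?w (a e) \<union> path_image (k e) else ecurve \<Gamma> e)" for e
  define \<Gamma>' where "\<Gamma>' = \<lparr>vpos = vpos \<Gamma>, ecurve = C\<rparr>"
  have \<Gamma>'[simp]: "vpos \<Gamma>' = vpos \<Gamma>" "ecurve \<Gamma>' = C" by (simp_all add: \<Gamma>'_def)
  have far: "z \<notin> cball ?w r" if "f \<in> E" "w \<notin> f" "z \<in> ecurve \<Gamma> f" for f z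
    using rY[of z] that unfolding Y_def by fastforce
  have meet1: "z \<in> ?p ` (e \<inter> f)" if "e \<in> E" "f \<in> E" "e \<noteq> f" "w \<in> e" "z \<in> C e" "z \<in> C f" for e f z
  proof -
    have e: "e \<in> E" "w \<in> e" by fact+
    have ze: "z \<in> closed_segment ?w (a e) \<or> z \<in> path_image (k e)" using that by (simp add: C_def)
    show ?thesis
    proof (cases "w \<in> f")
      case False
      then have zf: "z \<in> ecurve \<Gamma> f" using that by (simp add: C_def)
      then have "z \<notin> closed_segment ?w (a e)" using far[OF \<open>f \<in> E\<close> False] seg[OF e] by blast
      then have "z \<in> ecurve \<Gamma> e" using ze ak[OF e] by blast
      then show ?thesis using planar_curves_meet[OF G that(1-3)] zf by blast
    next
      case True
      have f: "f \<in> E" "w \<in> f" by fact+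
      have zf: "z \<in> closed_segment ?w (a f) \<or> z \<in> path_image (k f)" using that f by (simp add: C_def)
      consider "z \<in> closed_segment ?w (a e)" "z \<in> closed_segment ?w (a f)"
        | "z \<in> closed_segment ?w (a e)" "z \<in> path_image (k f)"
        | "z \<in> path_image (k e)" "z \<in> closed_segment ?w (a f)"
        | "z \<in> path_image (k e)" "z \<in> path_image (k f)" using ze zf by blast
      then show ?thesis
      proof cases
        case 1
        obtain s where s: "0 \<le> s" "z = (1 - s) *\<^sub>R ?w + s *\<^sub>R a e" using 1(1) by (auto simp: in_segment)
        obtain t where t: "0 \<le> t" "z = (1 - t) *\<^sub>R ?w + t *\<^sub>R a f" using 1(2) by (auto simp: in_segment)
        have zs: "z - ?w = s *\<^sub>R (a e - ?w)" by (subst s(2)) (simp add: algebra_simps)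
        have zt: "z - ?w = t *\<^sub>R (a f - ?w)" by (subst t(2)) (simp add: algebra_simps)
        have "norm (z - ?w) = s * r" unfolding zs using s(1) ak[OF e] by (simp add: dist_norm norm_minus_commute)
        moreover have "norm (z - ?w) = t * r" unfolding zt using t(1) ak[OF f] by (simp add: dist_norm norm_minus_commute)
        ultimately have "s = t" using r(1) by simp
        then have "s = 0 \<or> a e = a f" using zs zt by auto
        then have "z = ?w" using a_inj[OF e f] \<open>e \<noteq> f\<close> zs by auto
        then show ?thesis using e f by blast
      next
        case 2
        then have "z = a f" using seg[OF e] ak[OF f] by blast
        then show ?thesis using seg_eq[OF e f 2(1)] \<open>e \<noteq> f\<close> by blast
      next
        case 3
        then have "z = a e" using seg[OF f] ak[OF e] by blast
        then show ?thesis using seg_eq[OF f e 3(2)] \<open>e \<noteq> f\<close> by blast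
      next
        case 4
        then show ?thesis using planar_curves_meet[OF G that(1-3)] ak[OF e] ak[OF f] by blast
      qed
    qed
  qed
  have meet: "z \<in> ?p ` (e \<inter> f)" if "e \<in> E" "f \<in> E" "e \<noteq> f" "z \<in> C e" "z \<in> C f" for e f z
  proof -
    consider "w \<in> e" | "w \<in> f" | "w \<notin> e" "w \<notin> f" by blast
    then show ?thesis
    proof cases
      case 1 then show ?thesis using meet1 that by blast
    next
      case 2 then show ?thesis using meet1[of f e z] that by blast
    next
      case 3 then show ?thesis using planar_curves_meet[OF G that(1-3)] that(4,5) by (simp add: C_def)
    qed
  qed
  have "is_drawing V E \<Gamma>'"
    unfolding is_drawing_def \<Gamma>'
  proof (intro conjI ballI impI)
    show "inj_on ?p V" by fact
    fix e assume eE: "e \<in> E"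
    show "\<exists>g. arc g \<and> path_image g = C e \<and> {pathstart g, pathfinish g} = ?p ` e"
    proof (cases "w \<in> e")
      case True
      note e = eE True
      have k: "arc (k e)" "pathstart (k e) = a e" "path_image (k e) \<inter> cball ?w r = {a e}" using ak[OF e] by auto
      have "arc (linepath ?w (a e) +++ k e)"
        using seg[OF e] aw[OF e] k by (intro arc_join arc_linepath) auto
      moreover have "path_image (linepath ?w (a e) +++ k e) = C e"
        using e k(2) by (simp add: C_def path_image_join)
      ultimately show ?thesis using ak[OF e] by (intro exI[of _ "linepath ?w (a e) +++ k e"]) simp
    next
      case False
      then show ?thesis using drawing_arc_ex[OF D eE] by (simp add: C_def)
    qed
    fix v assume v: "v \<in> V" "?p v \<in> C e"
    show "v \<in> e"
    proof (cases "w \<in> e")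
      case True
      note e = eE True
      show ?thesis
      proof (cases "v = w")
        case False
        then have "dist ?w (?p v) > r" using rY[of "?p v"] v(1) unfolding Y_def by blast
        then have "?p v \<notin> closed_segment ?w (a e)" using seg[OF e] by auto
        then have "?p v \<in> ecurve \<Gamma> e" using v(2) ak[OF e] e by (auto simp: C_def)
        then show ?thesis using drawing_vertex_on_curve[OF D eE v(1)] by blast
      qed (use True in simp)
    next
      case False
      then show ?thesis using drawing_vertex_on_curve[OF D eE v(1)] v(2) by (simp add: C_def)
    qed
  qed
  then have "planar_drawing V E \<Gamma>'" using meet by (intro planar_drawingI) auto
  moreover have "C e \<subseteq> ecurve \<Gamma> e \<union> ball ?w \<epsilon>" if "e \<in> E" for e
  proof (cases "w \<in> e")
    case True
    have "cball ?w r \<subseteq> ball ?w \<epsilon>" using r(3) by auto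
    then show ?thesis using seg[OF that True] ak[OF that True] True that unfolding C_def by auto
  qed (auto simp: C_def)
  moreover have "free_at (\<Union>e\<in>E. C e) ?w"
  proof -
    \<comment> \<open>Close to \<open>w\<close> only radii remain, so the occupied directions form
      this finite set.\<close>
    define Dn where "Dn = (\<lambda>e. sgn (a e - ?w)) ` {e \<in> E. w \<in> e}"
    have "finite Dn" using fin(2) by (simp add: Dn_def)
    then obtain d where d: "norm d = 1" "d \<notin> Dn" using unit_direction_avoiding by blast
    then obtain \<delta> where \<delta>: "\<delta> > 0" "\<And>y. y \<in> Dn \<Longrightarrow> \<delta> \<le> dist d y"
      using separate_point_closed[of Dn d] \<open>finite Dn\<close> finite_imp_closed by blast
    have "min r \<delta> \<le> norm (sgn (z - ?w) - d)"
      if z: "z \<in> (\<Union>e\<in>E. C e)" "z \<noteq> ?w" "dist z ?w < min r \<delta>" for z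
    proof -
      obtain e where e: "e \<in> E" "z \<in> C e" using z(1) by blast
      have zr: "dist ?w z < r" using z(3) by (simp add: dist_commute)
      have we: "w \<in> e" using far[OF e(1), of z] e(2) zr by (auto simp: C_def split: if_splits)
      have "z \<noteq> a e" using ak[OF e(1) we] zr by auto
      then have "z \<notin> path_image (k e)" using ak[OF e(1) we] zr by fastforce
      then have "z \<in> closed_segment ?w (a e)" using e we by (simp add: C_def)
      then obtain s where s: "0 \<le> s" "z = (1 - s) *\<^sub>R ?w + s *\<^sub>R a e" by (auto simp: in_segment)
      then have "s \<noteq> 0" using z(2) by auto
      have "z - ?w = s *\<^sub>R (a e - ?w)" by (subst s(2)) (simp add: algebra_simps)
      then have "sgn (z - ?w) = sgn (a e - ?w)" using s(1) \<open>s \<noteq> 0\<close> by (simp add: sgn_scaleR)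
      then have "sgn (z - ?w) \<in> Dn" using e(1) we by (auto simp: Dn_def)
      then show ?thesis using \<delta>(2) by (force simp: dist_norm norm_minus_commute)
    qed
    then show ?thesis unfolding free_at_def using d(1) r(1) \<delta>(1)
      by (intro exI[of _ d] exI[of _ "min r \<delta>"]) auto
  qed
  ultimately show ?thesis by (intro exI[of _ \<Gamma>']) (auto simp: C_def)
qed

text \<open>The vertices are treated one at a time, in discs so small that a neighbourhood of every
  earlier vertex of \<open>S\<close> is left alone; its free sector survives because
  \<open>free_at\<close> is a local property.\<close>

lemma tame_vertices:
  assumes G: "simple_graph V E" "planar_drawing V E \<Gamma>" and "finite S" "S \<subseteq> V" and \<epsilon>: "\<forall>v\<in>S. \<epsilon> v > 0"
  shows "\<exists>\<Gamma>'. planar_drawing V E \<Gamma>' \<and> vpos \<Gamma>' = vpos \<Gamma>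
    \<and> (\<forall>e. e \<inter> S = {} \<longrightarrow> ecurve \<Gamma>' e = ecurve \<Gamma> e)
    \<and> (\<forall>e\<in>E. ecurve \<Gamma>' e \<subseteq> ecurve \<Gamma> e \<union> (\<Union>v\<in>e \<inter> S. ball (vpos \<Gamma> v) (\<epsilon> v)))
    \<and> (\<forall>v\<in>S. free_at (\<Union>e\<in>E. ecurve \<Gamma>' e) (vpos \<Gamma> v))"
  using \<open>finite S\<close> \<open>S \<subseteq> V\<close> \<epsilon>
proof (induction S rule: finite_induct)
  case empty
  then show ?case using G(2) by (intro exI[of _ \<Gamma>]) auto
next
  case (insert w S)
  let ?p = "vpos \<Gamma>"
  obtain \<Gamma>1 where \<Gamma>1: "planar_drawing V E \<Gamma>1" "vpos \<Gamma>1 = ?p"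
    "\<And>e. e \<inter> S = {} \<Longrightarrow> ecurve \<Gamma>1 e = ecurve \<Gamma> e"
    "\<And>e. e \<in> E \<Longrightarrow> ecurve \<Gamma>1 e \<subseteq> ecurve \<Gamma> e \<union> (\<Union>v\<in>e \<inter> S. ball (?p v) (\<epsilon> v))"
    "\<And>v. v \<in> S \<Longrightarrow> free_at (\<Union>e\<in>E. ecurve \<Gamma>1 e) (?p v)"
    using insert.IH insert.prems by (auto simp del: UN_simps)
  have inj: "inj_on ?p V" using G(2) by (simp add: planar_drawing_def is_drawing_def)
  have w: "w \<in> V" "\<epsilon> w > 0" using insert.prems by auto
  obtain d where d: "d > 0" "\<And>x. x \<in> ?p ` S \<Longrightarrow> x \<noteq> ?p w \<Longrightarrow> d \<le> dist (?p w) x"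
    using finite_set_avoid[of "?p ` S" "?p w"] insert.hyps(1) by auto
  define \<delta> where "\<delta> = min (\<epsilon> w) (d / 2)"
  have \<delta>: "\<delta> > 0" "\<delta> \<le> \<epsilon> w" "\<delta> \<le> d / 2" using w d(1) by (auto simp: \<delta>_def)
  obtain \<Gamma>2 where \<Gamma>2: "planar_drawing V E \<Gamma>2" "vpos \<Gamma>2 = ?p"
    "\<And>e. w \<notin> e \<Longrightarrow> ecurve \<Gamma>2 e = ecurve \<Gamma>1 e"
    "\<And>e. e \<in> E \<Longrightarrow> ecurve \<Gamma>2 e \<subseteq> ecurve \<Gamma>1 e \<union> ball (?p w) \<delta>"
    "free_at (\<Union>e\<in>E. ecurve \<Gamma>2 e) (?p w)"
    using tame_at[OF G(1) \<Gamma>1(1) w(1) \<delta>(1)] \<Gamma>1(2) by auto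
  have "free_at (\<Union>e\<in>E. ecurve \<Gamma>2 e) (?p v)" if v: "v \<in> S" for v
  proof (rule free_at_local[OF \<Gamma>1(5)[OF v]])
    show "d / 2 > 0" using d(1) by simp
    have "?p v \<noteq> ?p w" using v insert.hyps(2) insert.prems(1) inj_onD[OF inj, of v w] by blast
    then have "d \<le> dist (?p w) (?p v)" using d(2) v by blast
    then have "ball (?p w) \<delta> \<inter> ball (?p v) (d / 2) = {}" using \<delta>(3) by (intro disjoint_ballI) simp
    then show "(\<Union>e\<in>E. ecurve \<Gamma>2 e) \<inter> ball (?p v) (d / 2) \<subseteq> (\<Union>e\<in>E. ecurve \<Gamma>1 e)"
      using \<Gamma>2(4) by blast
  qed
  moreover have "ecurve \<Gamma>2 e \<subseteq> ecurve \<Gamma> e \<union> (\<Union>v\<in>e \<inter> insert w S. ball (?p v) (\<epsilon> v))" if e: "e \<in> E" for e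
  proof (cases "w \<in> e")
    case True
    have "ball (?p w) \<delta> \<subseteq> ball (?p w) (\<epsilon> w)" using \<delta>(2) by (rule subset_ball)
    then show ?thesis using \<Gamma>2(4)[OF e] \<Gamma>1(4)[OF e] True by blast
  next
    case False
    then show ?thesis using \<Gamma>2(3)[OF False] \<Gamma>1(4)[OF e] by blast
  qed
  ultimately show ?case using \<Gamma>2 \<Gamma>1(3) by (intro exI[of _ \<Gamma>2]) (simp del: UN_simps)
qed

text \<open>The curves of \<open>L\<close> and the vertices in \<open>A\<close> have to stay in
  place, while all other edges of the drawing may be carried along. The order matters:
  \<open>K\<close> is shrunk towards \<open>w\<close>, straightened at \<open>w\<close> to obtain a
  free direction, and moved into the sector. The other vertices are straightened last, since plane
  embeddings need not preserve free directions.\<close>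

lemma graft_component:
  assumes G: "simple_graph V E" "planar_drawing V E \<Gamma>" and F: "F \<subseteq> E" "forest F" "w \<in> \<Union> F"
  defines "K \<equiv> {f \<in> F. \<exists>x\<in>f. (w, x) \<in> (adj F)\<^sup>*}"
  assumes "L \<subseteq> E" "A \<subseteq> V" "\<Union> K \<inter> A = {w}" "\<Union> L \<inter> \<Union> K = {}" and d: "norm d = 1" "e > 0"
  shows "\<exists>\<Gamma>'. planar_drawing V E \<Gamma>' \<and> (\<forall>v\<in>A. vpos \<Gamma>' v = vpos \<Gamma> v) \<and> (\<forall>f\<in>L. ecurve \<Gamma>' f = ecurve \<Gamma> f)
    \<and> (\<Union>f\<in>K. ecurve \<Gamma>' f) - {vpos \<Gamma> w} \<subseteq> thin_sector (vpos \<Gamma> w) d e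
    \<and> (\<forall>v\<in>\<Union> K - {w}. free_at (\<Union>f\<in>K. ecurve \<Gamma>' f) (vpos \<Gamma>' v))"
proof -
  let ?p = "vpos \<Gamma>" and ?w = "vpos \<Gamma> w"
  have D: "is_drawing V E \<Gamma>" using G(2) by (simp add: planar_drawing_def)
  have finE: "finite E" and finV: "finite V" using G(1) finite_edges by (auto simp: simple_graph_def)
  have KF: "K \<subseteq> F" by (auto simp: K_def)
  then have KE: "K \<subseteq> E" using F(1) by blast
  have forK: "forest K" using F(2) KF by (rule forest_subset)
  have KV: "\<Union> K \<subseteq> V" using KE G(1) by (auto simp: simple_graph_def)
  have wK: "w \<in> \<Union> K" "w \<in> V" "w \<in> A" using assms(8,9) by blast+
  have wL: "w \<notin> f" if "f \<in> L" for f using that assms(10) wK(1) by blast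
  have curves: "compact (\<Union>f\<in>K. ecurve \<Delta> f)" "connected (- (\<Union>f\<in>K. ecurve \<Delta> f))" "vpos \<Delta> w \<in> (\<Union>f\<in>K. ecurve \<Delta> f)"
    "vpos \<Delta> ` \<Union> K \<subseteq> (\<Union>f\<in>K. ecurve \<Delta> f)" if \<Delta>: "planar_drawing V E \<Delta>" for \<Delta>
  proof -
    have D': "is_drawing V E \<Delta>" using \<Delta> by (simp add: planar_drawing_def)
    show "compact (\<Union>f\<in>K. ecurve \<Delta> f)"
      using finite_subset[OF KE finE] drawing_curve(1)[OF D'] KE by (intro compact_UN) auto
    show "connected (- (\<Union>f\<in>K. ecurve \<Delta> f))" using forest_complement_connected[OF G(1) \<Delta> KE forK] .
    show im: "vpos \<Delta> ` \<Union> K \<subseteq> (\<Union>f\<in>K. ecurve \<Delta> f)" using drawing_curve(4)[OF D'] KE by blast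
    show "vpos \<Delta> w \<in> (\<Union>f\<in>K. ecurve \<Delta> f)" using im wK(1) by blast
  qed
  define X0 where "X0 = (\<Union>f\<in>K. ecurve \<Gamma> f)"
  have X0: "compact X0" "connected (- X0)" "?w \<in> X0" unfolding X0_def by (rule curves[OF G(2)])+
  have conX0: "connected X0"
    using component_curves_connected[OF G(1) D F(1) F(3)] unfolding X0_def K_def .
  \<comment> \<open>\<open>Z\<close> is the obstacle to be fixed. It is disjoint from the curves of
    \<open>K\<close>, which can therefore be shrunk in its complement into a disc about
    \<open>w\<close> that misses \<open>Z\<close>.\<close>
  define Z where "Z = (\<Union>f\<in>L. ecurve \<Gamma> f) \<union> ?p ` (A - {w})"
  have ZX: "Z \<inter> X0 = {}"
  proof (rule ccontr)
    assume "Z \<inter> X0 \<noteq> {}"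
    then obtain z f where z: "z \<in> Z" "f \<in> K" "z \<in> ecurve \<Gamma> f" unfolding X0_def by blast
    have fE: "f \<in> E" using z(2) KE by blast
    from z(1) consider l where "l \<in> L" "z \<in> ecurve \<Gamma> l" | v where "v \<in> A - {w}" "z = ?p v"
      unfolding Z_def by blast
    then show False
    proof cases
      case (1 l)
      obtain x where "x \<in> f" using z(2) by (auto simp: K_def)
      then have "l \<noteq> f" using 1(1) z(2) assms(10) by blast
      then have "z \<in> ?p ` (l \<inter> f)"
        using planar_curves_meet[OF G _ fE] 1 z(3) \<open>L \<subseteq> E\<close> by blast
      then show False using 1(1) z(2) assms(10) by blast
    next
      case (2 v)
      then have "v \<in> f" using drawing_vertex_on_curve[OF D fE, of v] z(3) \<open>A \<subseteq> V\<close> by blast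
      then show False using 2(1) z(2) assms(9) by blast
    qed
  qed
  have "compact (\<Union>f\<in>L. ecurve \<Gamma> f)"
    using finite_subset[OF \<open>L \<subseteq> E\<close> finE] drawing_curve(1)[OF D] \<open>L \<subseteq> E\<close> by (intro compact_UN) auto
  moreover have "finite (?p ` (A - {w}))" using finV \<open>A \<subseteq> V\<close> finite_subset by blast
  ultimately have "closed Z" unfolding Z_def
    by (intro closed_Un compact_imp_closed finite_imp_closed)
  then have oU: "open (- Z)" by (rule open_Compl)
  moreover have "?w \<in> - Z" using X0(3) ZX by blast
  ultimately obtain r where r: "r > 0" "ball ?w r \<subseteq> - Z" using open_contains_ball by blast
  have XU: "X0 \<subseteq> - Z" using ZX by blast
  have r2: "r / 2 > 0" using r(1) by simp
  obtain h1 where h1: "plane_embedding h1" "h1 ?w = ?w" "\<And>z. z \<in> Z \<Longrightarrow> h1 z = z" "h1 ` X0 \<subseteq> ball ?w (r / 2)"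
    using shrink_into_ball[OF X0(1) conX0 X0(2,3) oU XU r2] by auto
  define \<Gamma>1 where "\<Gamma>1 = map_drawing h1 \<Gamma>"
  have P1: "planar_drawing V E \<Gamma>1" unfolding \<Gamma>1_def by (rule planar_drawing_map[OF h1(1) G(2)])
  have p1: "vpos \<Gamma>1 v = ?p v" if "v \<in> A" for v
    using that h1(2,3) by (cases "v = w") (auto simp: \<Gamma>1_def Z_def)
  have L1: "ecurve \<Gamma>1 f = ecurve \<Gamma> f" if "f \<in> L" for f
  proof -
    have "ecurve \<Gamma> f \<subseteq> Z" using that by (auto simp: Z_def)
    then show ?thesis unfolding \<Gamma>1_def using h1(3) by (auto simp: subset_iff image_iff)
  qed
  \<comment> \<open>Redrawing at \<open>w\<close> does not affect \<open>L\<close>, whose edges do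
    not contain \<open>w\<close>; the radius \<open>r / 2\<close> keeps the redrawn curves of
    \<open>K\<close> in the disc that misses \<open>Z\<close>.\<close>
  obtain \<Gamma>2 where \<Gamma>2: "planar_drawing V E \<Gamma>2" "vpos \<Gamma>2 = vpos \<Gamma>1"
    "\<And>f. w \<notin> f \<Longrightarrow> ecurve \<Gamma>2 f = ecurve \<Gamma>1 f"
    "\<And>f. f \<in> E \<Longrightarrow> ecurve \<Gamma>2 f \<subseteq> ecurve \<Gamma>1 f \<union> ball ?w (r / 2)"
    "free_at (\<Union>f\<in>E. ecurve \<Gamma>2 f) ?w"
    using tame_at[OF G(1) P1 wK(2) r2] p1[OF wK(3)] by auto
  define X2 where "X2 = (\<Union>f\<in>K. ecurve \<Gamma>2 f)"
  have X2: "compact X2" "connected (- X2)" "?w \<in> X2"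
    using curves[OF \<Gamma>2(1)] \<Gamma>2(2) p1[OF wK(3)] unfolding X2_def by auto
  have "X2 \<subseteq> ball ?w r"
  proof -
    have "ecurve \<Gamma>2 f \<subseteq> ball ?w (r / 2)" if f: "f \<in> K" for f
    proof -
      have "ecurve \<Gamma>1 f \<subseteq> ball ?w (r / 2)" using h1(4) f by (auto simp: \<Gamma>1_def X0_def)
      then show ?thesis using \<Gamma>2(4)[of f] f KE by blast
    qed
    moreover have "ball ?w (r / 2) \<subseteq> ball ?w r" using r(1) by (intro subset_ball) simp
    ultimately show ?thesis unfolding X2_def by blast
  qed
  moreover have "free_at X2 ?w"
    by (rule free_at_local[OF \<Gamma>2(5) r(1)]) (use KE in \<open>auto simp: X2_def\<close>)
  ultimately obtain h2 where h2: "plane_embedding h2" "h2 ?w = ?w" "\<And>z. z \<notin> ball ?w r \<Longrightarrow> h2 z = z"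
    "h2 ` (X2 - {?w}) \<subseteq> thin_sector ?w d e"
    using move_into_thin_sector[OF X2(1,3) _ r(1) X2(2) _ d] by blast
  define \<Gamma>3 where "\<Gamma>3 = map_drawing h2 \<Gamma>2"
  have P3: "planar_drawing V E \<Gamma>3" unfolding \<Gamma>3_def by (rule planar_drawing_map[OF h2(1) \<Gamma>2(1)])
  have D3: "is_drawing V E \<Gamma>3" using P3 by (simp add: planar_drawing_def)
  have out: "z \<notin> ball ?w r" if "z \<in> Z" for z using r(2) that by blast
  have p3: "vpos \<Gamma>3 v = ?p v" if v: "v \<in> A" for v
  proof (cases "v = w")
    case False
    then have "?p v \<in> Z" using v by (simp add: Z_def)
    then show ?thesis using h2(3)[OF out] by (simp add: \<Gamma>3_def \<Gamma>2(2) p1[OF v])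
  qed (simp add: \<Gamma>3_def \<Gamma>2(2) p1[OF wK(3)] h2(2))
  have L3: "ecurve \<Gamma>3 f = ecurve \<Gamma> f" if f: "f \<in> L" for f
  proof -
    have "ecurve \<Gamma>2 f = ecurve \<Gamma> f" using \<Gamma>2(3)[OF wL[OF f]] L1[OF f] by simp
    moreover have "ecurve \<Gamma> f \<subseteq> Z" using f by (auto simp: Z_def)
    then have "h2 ` ecurve \<Gamma> f = ecurve \<Gamma> f" using h2(3) out by (auto simp: subset_iff image_iff)
    ultimately show ?thesis by (simp add: \<Gamma>3_def)
  qed
  define X3 where "X3 = (\<Union>f\<in>K. ecurve \<Gamma>3 f)"
  have "X3 = h2 ` X2" by (auto simp: X3_def X2_def \<Gamma>3_def)
  then have X3: "X3 - {?w} \<subseteq> thin_sector ?w d e" using h2(2,4) by blast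
  let ?S = "\<Union> K - {w}"
  \<comment> \<open>The discs for the last redrawing have to lie in the open sector, so that the
    final curves do not leave it.\<close>
  have "\<exists>r>0. ball (vpos \<Gamma>3 v) r \<subseteq> thin_sector ?w d e" if v: "v \<in> ?S" for v
  proof -
    have "vpos \<Gamma>3 v \<in> X3" using curves(4)[OF P3] v unfolding X3_def by blast
    moreover have "inj_on (vpos \<Gamma>3) V" using D3 by (simp add: is_drawing_def)
    then have "vpos \<Gamma>3 v \<noteq> vpos \<Gamma>3 w" using v KV wK(2) by (auto dest: inj_onD)
    ultimately have "vpos \<Gamma>3 v \<in> thin_sector ?w d e" using X3 p3[OF wK(3)] by auto
    then show ?thesis using open_thin_sector open_contains_ball by blast
  qed
  then obtain \<epsilon> where \<epsilon>: "\<And>v. v \<in> ?S \<Longrightarrow> \<epsilon> v > 0" "\<And>v. v \<in> ?S \<Longrightarrow> ball (vpos \<Gamma>3 v) (\<epsilon> v) \<subseteq> thin_sector ?w d e"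
    by metis
  have SV: "?S \<subseteq> V" using KV by blast
  have "\<forall>v\<in>?S. \<epsilon> v > 0" using \<epsilon>(1) by blast
  from tame_vertices[OF G(1) P3 finite_subset[OF SV finV] SV this]
  obtain \<Gamma>4 where \<Gamma>4: "planar_drawing V E \<Gamma>4" "vpos \<Gamma>4 = vpos \<Gamma>3"
    "\<forall>f. f \<inter> ?S = {} \<longrightarrow> ecurve \<Gamma>4 f = ecurve \<Gamma>3 f"
    "\<forall>f\<in>E. ecurve \<Gamma>4 f \<subseteq> ecurve \<Gamma>3 f \<union> (\<Union>v\<in>f \<inter> ?S. ball (vpos \<Gamma>3 v) (\<epsilon> v))"
    "\<forall>v\<in>?S. free_at (\<Union>f\<in>E. ecurve \<Gamma>4 f) (vpos \<Gamma>3 v)"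
    by (elim exE conjE) (rule that; assumption)
  have "(\<Union>f\<in>K. ecurve \<Gamma>4 f) - {?w} \<subseteq> thin_sector ?w d e"
  proof -
    have "ecurve \<Gamma>4 f - {?w} \<subseteq> thin_sector ?w d e" if f: "f \<in> K" for f
    proof -
      have "ecurve \<Gamma>3 f - {?w} \<subseteq> thin_sector ?w d e" using X3 f unfolding X3_def by blast
      then show ?thesis using \<Gamma>4(4)[rule_format, of f] \<epsilon>(2) f KE by blast
    qed
    then show ?thesis by blast
  qed
  moreover have "free_at (\<Union>f\<in>K. ecurve \<Gamma>4 f) (vpos \<Gamma>4 v)" if v: "v \<in> ?S" for v
  proof -
    have "(\<Union>f\<in>K. ecurve \<Gamma>4 f) \<inter> ball (vpos \<Gamma>4 v) 1 \<subseteq> (\<Union>f\<in>E. ecurve \<Gamma>4 f)" using KE by blast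
    then show ?thesis using free_at_local[OF \<Gamma>4(5)[rule_format, OF v] zero_less_one] by (simp add: \<Gamma>4(2))
  qed
  moreover have "vpos \<Gamma>4 v = ?p v" if "v \<in> A" for v using p3[OF that] \<Gamma>4(2) by simp
  moreover have "ecurve \<Gamma>4 f = ecurve \<Gamma> f" if f: "f \<in> L" for f
  proof -
    have "f \<inter> ?S = {}" using f assms(10) by blast
    then show ?thesis using \<Gamma>4(3) L3[OF f] by simp
  qed
  ultimately show ?thesis using \<Gamma>4(1) by (intro exI[of _ \<Gamma>4] conjI ballI)
qed

subsection \<open>Simultaneous drawings along a tree\<close>

text \<open>
  The invariant of the construction: \<open>HH\<close> is the family of classes, \<open>col e\<close> is the class of the tree
  edge \<open>e\<close>, \<open>A\<close> and \<open>P\<close> are the placed vertices and edges, and \<open>p\<close> gives the common positions.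
  The implication on \<open>col\<close> says that \<open>P\<close> consists of entire components of the classes within \<open>T\<close>.
\<close>

definition placed_curves :: "('v set \<Rightarrow> 'v set set) \<Rightarrow> ('v set set \<Rightarrow> 'v drawing) \<Rightarrow> 'v set set \<Rightarrow> complex set" where
  "placed_curves col D P = (\<Union>e\<in>P. ecurve (D (col e)) e)"

definition partial_drawing ::
  "'v set \<Rightarrow> 'v set set set \<Rightarrow> ('v set \<Rightarrow> 'v set set) \<Rightarrow> 'v set set \<Rightarrow>
   'v set \<Rightarrow> 'v set set \<Rightarrow> ('v set set \<Rightarrow> 'v drawing) \<Rightarrow> ('v \<Rightarrow> complex) \<Rightarrow> bool" where
  "partial_drawing V HH col T A P D p \<longleftrightarrow>
     A \<subseteq> V \<and> A \<noteq> {} \<and> P \<subseteq> T \<and> \<Union> P \<subseteq> A \<and>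
     (\<forall>x\<in>A. \<forall>y\<in>A. (x, y) \<in> (adj P)\<^sup>*) \<and>
     (\<forall>e\<in>P. \<forall>f\<in>T. col e = col f \<longrightarrow> e \<inter> f \<noteq> {} \<longrightarrow> f \<in> P) \<and>
     (\<forall>H\<in>HH. planar_drawing V H (D H)) \<and>
     (\<forall>H\<in>HH. \<forall>v\<in>A. vpos (D H) v = p v) \<and>
     (\<forall>e\<in>P. \<forall>f\<in>P. e \<noteq> f \<longrightarrow>
        edge_interior (D (col e)) e \<inter> edge_interior (D (col f)) f = {}) \<and>
     (\<forall>v\<in>A. free_at (placed_curves col D P) (p v))"

lemma closed_imp_free_local:
  assumes "free_at X v" "closed Y" "v \<notin> Y"
  shows "free_at (X \<union> Y) v"
proof -
  obtain r where r: "r > 0" "ball v r \<subseteq> - Y"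
    using assms(2,3) open_contains_ball[of "- Y"] by auto
  show ?thesis by (rule free_at_local[OF assms(1) r(1)]) (use r(2) in blast)
qed

text \<open>A tree edge leaving \<open>A\<close> determines a class and in it a component
  \<open>K\<close> of tree edges. \<open>K\<close> is grafted in the drawing of its class; in every
  other class an embedding that fixes the placed curves and vertices brings the vertices of
  \<open>K\<close> to their new positions.\<close>

lemma extend_partial_drawing:
  fixes HH :: "'v set set set"
  assumes V: "finite V" and HH: "\<And>H. H \<in> HH \<Longrightarrow> simple_graph V H"
    and col: "\<And>e. e \<in> T \<Longrightarrow> col e \<in> HH \<and> e \<in> col e"
    and colH: "\<And>H e. H \<in> HH \<Longrightarrow> e \<in> T \<Longrightarrow> e \<in> H \<Longrightarrow> col e = H"
    and T: "simple_graph V T" "connected_graph V T" "forest T"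
    and part: "partial_drawing V HH col T A P D p" and "A \<noteq> V"
  shows "\<exists>A' P' D' p'. partial_drawing V HH col T A' P' D' p' \<and> A \<subset> A'"
proof -
  from part[unfolded partial_drawing_def]
  have AV: "A \<subseteq> V" and "A \<noteq> {}" and PT: "P \<subseteq> T" and PA: "\<Union> P \<subseteq> A"
    and conP: "\<forall>x\<in>A. \<forall>y\<in>A. (x, y) \<in> (adj P)\<^sup>*"
    and cl: "\<forall>e\<in>P. \<forall>f\<in>T. col e = col f \<longrightarrow> e \<inter> f \<noteq> {} \<longrightarrow> f \<in> P"
    and plan: "\<forall>H\<in>HH. planar_drawing V H (D H)"
    and pos: "\<forall>H\<in>HH. \<forall>v\<in>A. vpos (D H) v = p v"
    and cross: "\<forall>e\<in>P. \<forall>f\<in>P. e \<noteq> f \<longrightarrow>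
        edge_interior (D (col e)) e \<inter> edge_interior (D (col f)) f = {}"
    and free: "\<forall>v\<in>A. free_at (placed_curves col D P) (p v)"
    by - (elim conjE, assumption)+
  note conP = conP[rule_format] and cl = cl[rule_format] and plan = plan[rule_format]
    and pos = pos[rule_format] and cross = cross[rule_format] and free = free[rule_format]
  have finT: "finite T" using finite_edges[OF T(1)] .
  have finP: "finite P" using finT PT finite_subset by blast
  have two: "card e = 2" if "e \<in> T" for e using that T(1) by (simp add: simple_graph_def)
  obtain w v where wv: "w \<in> A" "v \<notin> A" "{w, v} \<in> T"
  proof -
    obtain a b where ab: "a \<in> A" "b \<in> V" "b \<notin> A" using \<open>A \<noteq> {}\<close> AV \<open>A \<noteq> V\<close> by blast
    then have "(a, b) \<in> {(x, y). {x, y} \<in> T}\<^sup>*" using T(2) AV by (auto simp: connected_graph_def)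
    moreover have "\<exists>w v. w \<in> A \<and> v \<notin> A \<and> {w, v} \<in> T"
      if "(a, b) \<in> {(x, y). {x, y} \<in> T}\<^sup>*" "b \<notin> A" for b
      using that by (induction rule: rtrancl_induct) (use ab(1) in auto)
    ultimately show thesis using that ab(3) by blast
  qed
  define H where "H = col {w, v}"
  have H: "H \<in> HH" using col[OF wv(3)] by (simp add: H_def)
  note GH = HH[OF H] plan[OF H]
  define F where "F = {e \<in> T. col e = H}"
  have FT: "F \<subseteq> T" and FH: "F \<subseteq> H" using col by (auto simp: F_def)
  have wF: "{w, v} \<in> F" using wv(3) by (simp add: F_def H_def)
  define K where "K = {f \<in> F. \<exists>x\<in>f. (w, x) \<in> (adj F)\<^sup>*}"
  have KF: "K \<subseteq> F" by (auto simp: K_def)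
  have KT: "K \<subseteq> T" using KF FT by (rule order_trans)
  have finK: "finite K" using finite_subset[OF KT finT] .
  have wvK: "{w, v} \<in> K" using wF by (auto simp: K_def)
  have reach: "(w, x) \<in> (adj F)\<^sup>*" if fx: "f \<in> K" "x \<in> f" for f x
  proof -
    obtain y where y: "y \<in> f" "(w, y) \<in> (adj F)\<^sup>*" using fx(1) by (auto simp: K_def)
    show ?thesis
    proof (cases "x = y")
      case False
      have "f \<in> T" using fx(1) KF FT by blast
      then have "f = {y, x}" using edge_cases[OF T(1), of f y] y(1) fx(2) False by (metis insertE singletonD)
      then have "(y, x) \<in> adj F" using fx(1) KF by (auto simp: adj_def)
      then show ?thesis using y(2) rtrancl_into_rtrancl by metis
    qed (use y in simp)
  qed
  have Kclosed: "f \<in> K" if "e \<in> K" "f \<in> F" "e \<inter> f \<noteq> {}" for e f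
    using that reach[OF that(1)] unfolding K_def by blast
  have reachK: "(w, x) \<in> (adj K)\<^sup>*" if "(w, x) \<in> (adj F)\<^sup>*" for x
    using that
  proof (induction rule: rtrancl_induct)
    case (step x y)
    then have "{x, y} \<in> K" by (auto simp: K_def adj_def)
    then have "(x, y) \<in> adj K" by (simp add: adj_def)
    then show ?case using step.IH rtrancl_into_rtrancl by metis
  qed simp
  \<comment> \<open>If the component of \<open>w\<close> in \<open>F\<close> met a placed edge of
    class \<open>H\<close>, the closure of \<open>P\<close> under adjacent edges of one class would
    spread back to \<open>{w, v}\<close>, although \<open>v\<close> is not placed.\<close>
  have noP: "x \<notin> \<Union> {e \<in> P. col e = H}" if "(w, x) \<in> (adj F)\<^sup>*" for x
    using that
  proof (induction rule: rtrancl_induct)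
    case base
    show ?case
    proof
      assume "w \<in> \<Union> {e \<in> P. col e = H}"
      then have "{w, v} \<in> P" using cl[OF _ wv(3)] by (auto simp: H_def)
      then show False using PA wv(2) by blast
    qed
  next
    case (step x y)
    have xy: "{x, y} \<in> T" "col {x, y} = H" using step.hyps(2) by (auto simp: adj_def F_def)
    show ?case
    proof
      assume "y \<in> \<Union> {e \<in> P. col e = H}"
      then have "{x, y} \<in> P" using cl[OF _ xy(1)] xy(2) by auto
      then show False using step.IH xy(2) by blast
    qed
  qed
  let ?L = "{e \<in> P. col e = H}"
  have LK: "\<Union> ?L \<inter> \<Union> K = {}" using noP reach by blast
  have KP: "K \<inter> P = {}"
  proof (rule ccontr)
    assume "K \<inter> P \<noteq> {}"
    then obtain f where f: "f \<in> K" "f \<in> P" by blast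
    then obtain x where "x \<in> f" by (auto simp: K_def)
    moreover have "f \<in> ?L" using f KF by (auto simp: F_def)
    ultimately show False using LK f(1) by blast
  qed
  \<comment> \<open>\<open>K\<close> and \<open>P\<close> are edge-disjoint and each is connected,
    so by the forest property a second common vertex is impossible.\<close>
  have AK: "\<Union> K \<inter> A = {w}"
  proof
    show "{w} \<subseteq> \<Union> K \<inter> A" using wvK wv(1) by blast
    show "\<Union> K \<inter> A \<subseteq> {w}"
    proof
      fix x assume x: "x \<in> \<Union> K \<inter> A"
      then have "(w, x) \<in> (adj K)\<^sup>*" using reach reachK by blast
      moreover have "(w, x) \<in> (adj P)\<^sup>*" using conP wv(1) x by blast
      ultimately have "w = x" using forest_connections_disjoint[OF T(3) finK KT PT KP two, of w x] by simp
      then show "x \<in> {w}" by simp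
    qed
  qed
  have KV: "\<Union> K \<subseteq> V" using KF FT T(1) by (auto simp: simple_graph_def)
  let ?X = "placed_curves col D P"
  obtain d e where de: "norm d = 1" "e > 0" "?X \<inter> thin_sector (p w) d e = {}"
    "\<And>Y. Y - {p w} \<subseteq> thin_sector (p w) d e \<Longrightarrow> free_at (?X \<union> Y) (p w)"
    using free_at_attach[OF free[OF wv(1)]] by metis
  have "\<exists>\<Gamma>'. planar_drawing V H \<Gamma>' \<and> (\<forall>v\<in>A. vpos \<Gamma>' v = vpos (D H) v) \<and> (\<forall>f\<in>?L. ecurve \<Gamma>' f = ecurve (D H) f)
    \<and> (\<Union>f\<in>K. ecurve \<Gamma>' f) - {vpos (D H) w} \<subseteq> thin_sector (vpos (D H) w) d e
    \<and> (\<forall>v\<in>\<Union> K - {w}. free_at (\<Union>f\<in>K. ecurve \<Gamma>' f) (vpos \<Gamma>' v))"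
    unfolding K_def
  proof (rule graft_component[OF GH FH forest_subset[OF T(3) FT]])
    show "w \<in> \<Union> F" using wF by blast
    show "?L \<subseteq> H" using col PT by blast
  qed (use AV AK LK de in \<open>simp_all add: K_def\<close>)
  then obtain \<Gamma>' where \<Gamma>': "planar_drawing V H \<Gamma>'" "\<And>v. v \<in> A \<Longrightarrow> vpos \<Gamma>' v = p v"
    "\<And>f. f \<in> P \<Longrightarrow> col f = H \<Longrightarrow> ecurve \<Gamma>' f = ecurve (D H) f"
    "(\<Union>f\<in>K. ecurve \<Gamma>' f) - {p w} \<subseteq> thin_sector (p w) d e"
    "\<And>v. v \<in> \<Union> K - {w} \<Longrightarrow> free_at (\<Union>f\<in>K. ecurve \<Gamma>' f) (vpos \<Gamma>' v)"
    using pos[OF H] wv(1) by auto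
  let ?Y = "\<Union>f\<in>K. ecurve \<Gamma>' f" and ?q = "vpos \<Gamma>'"
  have D': "is_drawing V H \<Gamma>'" using \<Gamma>'(1) by (simp add: planar_drawing_def)
  have injq: "inj_on ?q V" using D' by (simp add: is_drawing_def)
  \<comment> \<open>The chosen sector contains no placed curve, so old and new curves meet at most
    at the position of \<open>w\<close>.\<close>
  have XY: "?X \<inter> ?Y \<subseteq> {p w}" using \<Gamma>'(4) de(3) by blast
  have qY: "?q x \<in> ?Y" if x: "x \<in> \<Union> K" for x
  proof -
    obtain f where f: "f \<in> K" "x \<in> f" using x by blast
    then have "f \<in> H" using KF FH by blast
    then show ?thesis using drawing_curve(4)[OF D'] f by blast
  qed
  have qX: "?q x \<notin> ?X" if x: "x \<in> \<Union> K - {w}" for x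
  proof
    assume "?q x \<in> ?X"
    then have "?q x = p w" using qY x XY by blast
    then have "?q x = ?q w" using \<Gamma>'(2) wv(1) by simp
    then have "x = w" using inj_onD[OF injq] x KV AV wv(1) by blast
    then show False using x by simp
  qed
  \<comment> \<open>In each class the placed edges form a forest, whose curves do not separate the
    plane; a separate embedding per class thus reaches the same new positions
    \<open>?q\<close>.\<close>
  have move: "\<exists>h. plane_embedding h \<and> (\<forall>v\<in>\<Union> K - {w}. h (vpos (D H') v) = ?q v)
      \<and> (\<forall>z\<in>(\<Union>f\<in>{f \<in> P. col f = H'}. ecurve (D H') f) \<union> vpos (D H') ` A. h z = z)" if H': "H' \<in> HH" for H'
  proof (rule move_vertices[OF HH[OF H'] plan[OF H']])
    show "{f \<in> P. col f = H'} \<subseteq> H'" using col PT by blast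
    show "forest {f \<in> P. col f = H'}" using PT by (intro forest_subset[OF T(3)]) auto
    show "inj_on ?q (\<Union> K - {w})" using injq KV by (auto intro: inj_on_subset)
    show "\<Union> K - {w} \<subseteq> V" "(\<Union> K - {w}) \<inter> A = {}" using KV AK by blast+
    then show "(\<Union> K - {w}) \<inter> \<Union> {f \<in> P. col f = H'} = {}" using PA by blast
    fix x assume x: "x \<in> \<Union> K - {w}"
    have "?q x \<notin> (\<Union>f\<in>{f \<in> P. col f = H'}. ecurve (D H') f)"
      using qX[OF x] by (auto simp: placed_curves_def)
    moreover have "?q x \<notin> vpos (D H') ` A"
    proof
      assume "?q x \<in> vpos (D H') ` A"
      then obtain a where "a \<in> A" "?q x = ?q a" using pos[OF H'] \<Gamma>'(2) by auto
      then have "x = a" using inj_onD[OF injq] x KV AV by blast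
      then show False using x AK \<open>a \<in> A\<close> by blast
    qed
    ultimately show "?q x \<notin> (\<Union>f\<in>{f \<in> P. col f = H'}. ecurve (D H') f) \<union> vpos (D H') ` A" by blast
  qed (rule AV)
  have "\<exists>h. \<forall>H'\<in>HH. plane_embedding (h H') \<and> (\<forall>v\<in>\<Union> K - {w}. h H' (vpos (D H') v) = ?q v)
      \<and> (\<forall>z\<in>(\<Union>f\<in>{f \<in> P. col f = H'}. ecurve (D H') f) \<union> vpos (D H') ` A. h H' z = z)"
    by (rule bchoice, rule ballI, rule move)
  then obtain h where h_all: "\<forall>H'\<in>HH. plane_embedding (h H') \<and> (\<forall>v\<in>\<Union> K - {w}. h H' (vpos (D H') v) = ?q v)
      \<and> (\<forall>z\<in>(\<Union>f\<in>{f \<in> P. col f = H'}. ecurve (D H') f) \<union> vpos (D H') ` A. h H' z = z)"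
    by (rule exE)
  have h: "plane_embedding (h H')" "x \<in> \<Union> K - {w} \<Longrightarrow> h H' (vpos (D H') x) = ?q x"
    "z \<in> (\<Union>f\<in>{f \<in> P. col f = H'}. ecurve (D H') f) \<union> vpos (D H') ` A \<Longrightarrow> h H' z = z"
    if "H' \<in> HH" for H' x z
    using bspec[OF h_all that] by (simp_all del: UN_simps)
  define D1 where "D1 H' = (if H' = H then \<Gamma>' else map_drawing (h H') (D H'))" for H'
  have plan1: "planar_drawing V H' (D1 H')" if "H' \<in> HH" for H'
    using \<Gamma>'(1) planar_drawing_map[OF h(1) plan] that by (simp add: D1_def)
  have pos1: "vpos (D1 H') x = ?q x" if "H' \<in> HH" "x \<in> A \<union> \<Union> K" for H' x
  proof (cases "x \<in> A")
    case True
    have "h H' (vpos (D H') x) = vpos (D H') x" by (rule h(3)[OF that(1)]) (use True in blast)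
    then show ?thesis using pos[OF that(1) True] \<Gamma>'(2)[OF True] by (simp add: D1_def)
  next
    case False
    then have "x \<in> \<Union> K - {w}" using that(2) wv(1) by blast
    then show ?thesis using h(2)[OF that(1)] by (simp add: D1_def)
  qed
  have curve1: "ecurve (D1 (col f)) f = ecurve (D (col f)) f" if f: "f \<in> P" for f
  proof (cases "col f = H")
    case False
    have "col f \<in> HH" using col f PT by blast
    then have "h (col f) z = z" if "z \<in> ecurve (D (col f)) f" for z using h(3) f that by blast
    then show ?thesis using False by (simp add: D1_def)
  qed (use \<Gamma>'(3)[OF f] in \<open>simp add: D1_def\<close>)
  have int1: "edge_interior (D1 (col f)) f = edge_interior (D (col f)) f" if f: "f \<in> P" for f
  proof -
    have "col f \<in> HH" using col f PT by blast
    then have "vpos (D1 (col f)) x = vpos (D (col f)) x" if "x \<in> f" for x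
      using pos1 pos \<Gamma>'(2) that f PA by (metis UnCI UnionI subsetD)
    then show ?thesis using curve1[OF f] by (simp add: edge_interior_def cong: image_cong)
  qed
  have KD1: "D1 (col f) = \<Gamma>'" if "f \<in> K" for f using that KF by (auto simp: F_def D1_def)
  have X1: "placed_curves col D1 (P \<union> K) = ?X \<union> ?Y"
    using curve1 KD1 by (simp add: placed_curves_def UN_Un)
  have "compact ?X"
  proof -
    have "compact (ecurve (D (col f)) f)" if "f \<in> P" for f
      using drawing_curve(1)[of V "col f" "D (col f)" f] plan[of "col f"] col[of f] that PT by (auto simp: planar_drawing_def)
    then show ?thesis unfolding placed_curves_def using finP by (intro compact_UN) auto
  qed
  then have clX: "closed ?X" by (rule compact_imp_closed)
  have "compact ?Y"
  proof -
    show ?thesis using finK drawing_curve(1)[OF D'] KF FH by (intro compact_UN) auto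
  qed
  then have clY: "closed ?Y" by (rule compact_imp_closed)
  have "partial_drawing V HH col T (A \<union> \<Union> K) (P \<union> K) D1 ?q"
    unfolding partial_drawing_def
  proof (intro conjI ballI impI)
    show "A \<union> \<Union> K \<subseteq> V" "A \<union> \<Union> K \<noteq> {}" "P \<union> K \<subseteq> T" "\<Union> (P \<union> K) \<subseteq> A \<union> \<Union> K"
      using AV KV wv(1) PT KF FT PA by blast+
    have tow: "(w, x) \<in> (adj (P \<union> K))\<^sup>*" if "x \<in> A \<union> \<Union> K" for x
      using that conP[OF wv(1)] reach reachK adj_mono[of P "P \<union> K"] adj_mono[of K "P \<union> K"] by blast
    show "(x, y) \<in> (adj (P \<union> K))\<^sup>*" if "x \<in> A \<union> \<Union> K" "y \<in> A \<union> \<Union> K" for x y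
      using tow[OF that(1)] tow[OF that(2)] adj_sym rtrancl_trans by metis
    show "f \<in> P \<union> K" if "e \<in> P \<union> K" "f \<in> T" "col e = col f" "e \<inter> f \<noteq> {}" for e f
    proof (cases "e \<in> P")
      case False
      then have "e \<in> K" using that(1) by blast
      moreover have "f \<in> F" using that calculation KF by (auto simp: F_def)
      ultimately show ?thesis using Kclosed that(4) by blast
    qed (use cl that in blast)
    show "planar_drawing V H' (D1 H')" if "H' \<in> HH" for H' using plan1 that .
    show "vpos (D1 H') x = ?q x" if "H' \<in> HH" "x \<in> A \<union> \<Union> K" for H' x using pos1 that .
    \<comment> \<open>A common point would be the position of \<open>w\<close>, which lies on the
      curve of \<open>g\<close> only as an end of \<open>g\<close>, hence not in its
      interior.\<close>
    have PK: "edge_interior (D1 (col f)) f \<inter> edge_interior (D1 (col g)) g = {}" if fg: "f \<in> P" "g \<in> K" for f g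
    proof (rule ccontr)
      assume "\<not> ?thesis"
      then obtain z where z: "z \<in> ecurve (D1 (col f)) f" "z \<in> ecurve \<Gamma>' g" "z \<notin> ?q ` g"
        using KD1[OF fg(2)] by (auto simp: edge_interior_def)
      have "z \<in> ?X" using z(1) fg(1) curve1[OF fg(1)] by (auto simp: placed_curves_def)
      moreover have "z \<in> ?Y" using z(2) fg(2) by blast
      ultimately have "z \<in> ?X \<inter> ?Y" by (rule IntI)
      then have "z \<in> {p w}" using XY by (rule subsetD[rotated])
      then have "z = ?q w" using \<Gamma>'(2)[OF wv(1)] by simp
      moreover have "g \<in> H" using fg(2) KF FH by blast
      ultimately have "w \<in> g" using drawing_vertex_on_curve[OF D', of g w] z(2) AV wv(1) by auto
      then show False using z(3) \<open>z = ?q w\<close> by blast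
    qed
    show "edge_interior (D1 (col f)) f \<inter> edge_interior (D1 (col g)) g = {}"
      if fg: "f \<in> P \<union> K" "g \<in> P \<union> K" "f \<noteq> g" for f g
    proof -
      consider "f \<in> P" "g \<in> P" | "f \<in> P" "g \<in> K" | "f \<in> K" "g \<in> P" | "f \<in> K" "g \<in> K" using fg(1,2) by blast
      then show ?thesis
      proof cases
        case 1 then show ?thesis using int1 cross fg(3) by simp
      next
        case 2 then show ?thesis by (rule PK)
      next
        case 3 then show ?thesis using PK[of g f] by blast
      next
        case 4
        then have "f \<in> H" "g \<in> H" using KF FH by blast+
        then show ?thesis using \<Gamma>'(1) fg(3) KD1 4 by (auto simp: planar_drawing_def edges_cross_def)
      qed
    qed
    fix x assume x: "x \<in> A \<union> \<Union> K"
    \<comment> \<open>At \<open>w\<close> the room left in the sector serves. At any other vertex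
      either only old or only new curves arrive, and the other closed set keeps a positive
      distance.\<close>
    show "free_at (placed_curves col D1 (P \<union> K)) (?q x)"
      unfolding X1
    proof (cases "x = w")
      case True
      then show "free_at (?X \<union> ?Y) (?q x)" using de(4) \<Gamma>'(2,4) wv(1) by simp
    next
      case False
      show "free_at (?X \<union> ?Y) (?q x)"
      proof (cases "x \<in> A")
        case True
        have "(w, x) \<in> (adj P)\<^sup>*" using conP wv(1) True by blast
        then obtain f where f: "f \<in> P" "x \<in> f" using False by (cases rule: rtranclE) (auto simp: adj_def)
        have cf: "col f \<in> HH" "f \<in> col f" using col f(1) PT by blast+
        then have "vpos (D (col f)) x \<in> ecurve (D (col f)) f"
          using drawing_curve(4)[of V "col f" "D (col f)" f] plan f(2) by (auto simp: planar_drawing_def)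
        then have xX: "?q x \<in> ?X" using pos[OF cf(1) True] \<Gamma>'(2)[OF True] f(1) by (auto simp: placed_curves_def)
        have "?q x \<noteq> ?q w" using inj_onD[OF injq, of x w] False True wv(1) AV by blast
        then have "?q x \<notin> ?Y" using xX XY \<Gamma>'(2)[OF wv(1)] by auto
        then show ?thesis using closed_imp_free_local[OF _ clY] free[OF True] \<Gamma>'(2)[OF True] by simp
      next
        case notA: False
        then have xK: "x \<in> \<Union> K - {w}" using x False by blast
        then have "free_at (?Y \<union> ?X) (?q x)" by (intro closed_imp_free_local \<Gamma>'(5) clX qX)
        then show ?thesis by (simp add: Un_commute)
      qed
    qed
  qed
  moreover have "v \<in> \<Union> K" using wvK by blast
  then have "A \<subset> A \<union> \<Union> K" using wv(2) by blast
  ultimately show ?thesis by blast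
qed

text \<open>Starting from a single vertex, translated to 0 in every drawing, components are attached
  until all vertices are placed; each attachment enlarges the set of placed vertices.\<close>

lemma simultaneous_tree_drawing:
  fixes HH :: "'v set set set"
  assumes T: "tree_graph V T" and planar: "\<And>H. H \<in> HH \<Longrightarrow> planar_graph V H"
    and disjoint: "\<And>H H'. H \<in> HH \<Longrightarrow> H' \<in> HH \<Longrightarrow> H \<noteq> H' \<Longrightarrow> H \<inter> H' = {}" and cover: "T \<subseteq> \<Union> HH"
  shows "\<exists>D p. (\<forall>H\<in>HH. planar_drawing V H (D H) \<and> (\<forall>v\<in>V. vpos (D H) v = p v)) \<and>
    (\<forall>H\<in>HH. \<forall>H'\<in>HH. \<forall>e\<in>T \<inter> H. \<forall>f\<in>T \<inter> H'. e \<noteq> f \<longrightarrow>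
       edge_interior (D H) e \<inter> edge_interior (D H') f = {})"
proof -
  have GT: "simple_graph V T" "connected_graph V T" "forest T"
    using T tree_graph_forest by (auto simp: tree_graph_def)
  have simple: "simple_graph V H" if "H \<in> HH" for H using planar[OF that] by (simp add: planar_graph_def)
  have finV: "finite V" using GT(1) by (simp add: simple_graph_def)
  have "\<forall>e\<in>T. \<exists>H. H \<in> HH \<and> e \<in> H" using cover by blast
  then obtain col where col: "\<And>e. e \<in> T \<Longrightarrow> col e \<in> HH \<and> e \<in> col e" by metis
  have colH: "col e = H" if "H \<in> HH" "e \<in> T" "e \<in> H" for H e
    using disjoint[of "col e" H] col[OF that(2)] that by blast
  have "\<exists>\<Gamma>. planar_drawing V H \<Gamma>" if "H \<in> HH" for H using planar[OF that] by (simp add: planar_graph_def)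
  then obtain D0 where D0: "\<And>H. H \<in> HH \<Longrightarrow> planar_drawing V H (D0 H)" by metis
  obtain v0 where v0: "v0 \<in> V" using GT(2) by (auto simp: connected_graph_def)
  define D1 where "D1 H = map_drawing (\<lambda>z. z + - vpos (D0 H) v0) (D0 H)" for H
  have init: "partial_drawing V HH col T {v0} {} D1 (\<lambda>_. 0)"
    unfolding partial_drawing_def
  proof (intro conjI ballI impI)
    show "planar_drawing V H (D1 H)" if "H \<in> HH" for H
      unfolding D1_def by (rule planar_drawing_map[OF plane_embedding_add D0[OF that]])
    show "free_at (placed_curves col D1 {}) 0"
      unfolding free_at_def placed_curves_def by (intro exI[of _ 1]) simp
  qed (use v0 in \<open>auto simp: D1_def\<close>)
  have "\<exists>P' D' p'. partial_drawing V HH col T V P' D' p'" if "partial_drawing V HH col T A P D p" for A P D p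
    using that
  proof (induction "card (V - A)" arbitrary: A P D p rule: less_induct)
    case less
    show ?case
    proof (cases "A = V")
      case False
      obtain A' P' D' p' where ext: "partial_drawing V HH col T A' P' D' p'" "A \<subset> A'"
        using extend_partial_drawing[OF finV simple col colH GT less.prems False] by blast
      moreover have "A' \<subseteq> V" using ext(1) by (simp add: partial_drawing_def)
      then have "card (V - A') < card (V - A)" using ext(2) finV by (intro psubset_card_mono) auto
      ultimately show ?thesis using less.hyps by blast
    qed (use less.prems in blast)
  qed
  then obtain P D p where part: "partial_drawing V HH col T V P D p" using init by blast
  then have plan: "\<forall>H\<in>HH. planar_drawing V H (D H)" and pos: "\<forall>H\<in>HH. \<forall>v\<in>V. vpos (D H) v = p v"
    and PT: "P \<subseteq> T" and conP: "\<forall>x\<in>V. \<forall>y\<in>V. (x, y) \<in> (adj P)\<^sup>*"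
    and cross: "\<forall>e\<in>P. \<forall>f\<in>P. e \<noteq> f \<longrightarrow> edge_interior (D (col e)) e \<inter> edge_interior (D (col f)) f = {}"
    unfolding partial_drawing_def by - (elim conjE, assumption)+
  \<comment> \<open>Once the placed edges connect all vertices, an unplaced tree edge would fail to
    be a bridge.\<close>
  have "T \<subseteq> P"
  proof
    fix e assume e: "e \<in> T"
    then obtain u v where uv: "e = {u, v}" "u \<noteq> v" "u \<in> V" "v \<in> V"
      using GT(1) by (auto simp: simple_graph_def card_2_iff)
    show "e \<in> P"
    proof (rule ccontr)
      assume "e \<notin> P"
      then have "(adj P)\<^sup>* \<subseteq> (adj (T - {e}))\<^sup>*" using PT by (intro adj_mono) blast
      then have "(u, v) \<in> (adj (T - {{u, v}}))\<^sup>*" using conP uv by blast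
      then show False using GT(3) e uv(1,2) by (simp add: forest_def)
    qed
  qed
  then have "edge_interior (D H) e \<inter> edge_interior (D H') f = {}"
    if "H \<in> HH" "H' \<in> HH" "e \<in> T \<inter> H" "f \<in> T \<inter> H'" "e \<noteq> f" for H H' e f
    using cross colH that by (metis IntE subsetD)
  then show ?thesis using plan pos by (intro exI[of _ D] exI[of _ p] conjI ballI impI) simp_all
qed

section \<open>Choice of the classes and the joint drawing\<close>

lemma planar_graph_single_edge:
  assumes "finite V" "e \<subseteq> V" "card e = 2"
  shows "planar_graph V {e}"
proof -
  obtain u v where uv: "e = {u, v}" "u \<noteq> v" using assms(3) by (auto simp: card_2_iff)
  obtain k :: "'a \<Rightarrow> nat" where k: "inj_on k V" using finite_imp_inj_to_nat_seg[OF assms(1)] by blast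
  \<comment> \<open>The edge is the real segment from 0 to 1, and all other vertices go to the
    imaginary axis; adding 1 keeps them off the origin, where \<open>u\<close> lies, even if
    \<open>k x = 0\<close>.\<close>
  define p where "p x = (if x = u then 0 else if x = v then 1 else Complex 0 (1 + real (k x)))" for x
  define \<Gamma> where "\<Gamma> = \<lparr>vpos = p, ecurve = (\<lambda>_. closed_segment 0 1)\<rparr>"
  have real: "Im z = 0" if "z \<in> closed_segment (0::complex) 1" for z
    using that by (auto simp: in_segment)
  have on: "x = u \<or> x = v" if "p x \<in> closed_segment 0 1" for x
    using real[OF that] by (auto simp: p_def split: if_splits)
  have "inj_on p V" using k by (auto simp: inj_on_def p_def complex_eq_iff)
  moreover have "arc (linepath 0 (1::complex))" by simp
  moreover have "{pathstart (linepath 0 (1::complex)), pathfinish (linepath 0 1)} = p ` e"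
    using uv by (auto simp: p_def)
  ultimately have "is_drawing V {e} \<Gamma>" using on uv
    unfolding is_drawing_def \<Gamma>_def by (auto intro!: exI[of _ "linepath 0 1"])
  then have "planar_drawing V {e} \<Gamma>" by (simp add: planar_drawing_def edges_cross_def)
  then show ?thesis using assms by (auto simp: planar_graph_def simple_graph_def)
qed

lemma planar_drawing_cong:
  assumes "planar_drawing V E \<Gamma>" "simple_graph V E"
    and "\<And>v. v \<in> V \<Longrightarrow> vpos \<Delta> v = vpos \<Gamma> v" "\<And>e. e \<in> E \<Longrightarrow> ecurve \<Delta> e = ecurve \<Gamma> e"
  shows "planar_drawing V E \<Delta>"
proof -
  have "vpos \<Delta> ` e = vpos \<Gamma> ` e" if "e \<in> E" for e
    using that assms(2,3) by (intro image_cong) (auto simp: simple_graph_def)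
  moreover have "inj_on (vpos \<Delta>) V \<longleftrightarrow> inj_on (vpos \<Gamma>) V" using assms(3) by (rule inj_on_cong)
  ultimately show ?thesis using assms(1,3,4)
    unfolding planar_drawing_def is_drawing_def edges_cross_def edge_interior_def by simp
qed

theorem theorem2:
  fixes V :: "'v set" and E1 E2 E3 :: "'v set set"
  assumes "planar_graph V E1"
    and "tree_graph V E2"
    and "planar_graph V E3"
  shows "\<exists>\<Gamma>1 \<Gamma>2 \<Gamma>3. is_QuaSEFE V [E1, E2, E3] [\<Gamma>1, \<Gamma>2, \<Gamma>3] \<and>
           planar_drawing V E1 \<Gamma>1 \<and> planar_drawing V E2 \<Gamma>2"
proof -
  \<comment> \<open>Taking away \<open>E1\<close> makes the classes disjoint, so that each edge
    obtains its curve from a single class.\<close>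
  define B where "B = E3 - E1"
  \<comment> \<open>With one-element classes the planarity of the tree is not presupposed; it
    results from the construction.\<close>
  define S where "S = (\<lambda>e. {e}) ` (E2 - E1 - E3)"
  define HH where "HH = insert E1 (insert B S)"
  have simple: "simple_graph V E1" "simple_graph V E2" "simple_graph V E3"
    using assms by (auto simp: planar_graph_def tree_graph_def)
  have finV: "finite V" using simple(1) by (simp add: simple_graph_def)
  have BB: "simple_graph V B" using simple(3) by (auto simp: B_def simple_graph_def)
  obtain \<Gamma> where "planar_drawing V E3 \<Gamma>" using assms(3) by (auto simp: planar_graph_def)
  then have "planar_drawing V B \<Gamma>" by (simp add: B_def planar_drawing_def is_drawing_def)
  then have "planar_graph V B" using BB by (auto simp: planar_graph_def)
  moreover have "planar_graph V H" if "H \<in> S" for H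
    using that simple(2) planar_graph_single_edge[OF finV] by (auto simp: S_def simple_graph_def)
  ultimately have planar: "planar_graph V H" if "H \<in> HH" for H using that assms(1) by (auto simp: HH_def)
  have disj: "H \<inter> H' = {}" if "H \<in> HH" "H' \<in> HH" "H \<noteq> H'" for H H'
    using that by (auto simp: HH_def B_def S_def)
  have cover: "E2 \<subseteq> \<Union> HH" by (auto simp: HH_def B_def S_def)
  have "\<exists>D p. (\<forall>H\<in>HH. planar_drawing V H (D H) \<and> (\<forall>v\<in>V. vpos (D H) v = p v)) \<and>
    (\<forall>H\<in>HH. \<forall>H'\<in>HH. \<forall>e\<in>E2 \<inter> H. \<forall>f\<in>E2 \<inter> H'. e \<noteq> f \<longrightarrow>
       edge_interior (D H) e \<inter> edge_interior (D H') f = {})"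
    by (rule simultaneous_tree_drawing[OF assms(2)]) (rule planar, assumption, rule disj, assumption+, rule cover)
  then obtain D p where D: "\<forall>H\<in>HH. planar_drawing V H (D H) \<and> (\<forall>v\<in>V. vpos (D H) v = p v)"
    and cross: "\<forall>H\<in>HH. \<forall>H'\<in>HH. \<forall>e\<in>E2 \<inter> H. \<forall>f\<in>E2 \<inter> H'. e \<noteq> f \<longrightarrow>
       edge_interior (D H) e \<inter> edge_interior (D H') f = {}"
    by (elim exE conjE) (rule that; assumption)
  \<comment> \<open>Each edge takes its curve from the drawing of its own class. The resulting
    drawing \<Delta> serves all three graphs, so shared vertices and edges agree
    automatically.\<close>
  define c where "c e = (if e \<in> E1 then ecurve (D E1) e else if e \<in> E3 then ecurve (D B) e else ecurve (D {e}) e)" for e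
  define \<Delta> where "\<Delta> = \<lparr>vpos = p, ecurve = c\<rparr>"
  have \<Delta>[simp]: "vpos \<Delta> = p" "ecurve \<Delta> = c" by (simp_all add: \<Delta>_def)
  have inHH: "E1 \<in> HH" "B \<in> HH" by (simp_all add: HH_def)
  have P1: "planar_drawing V E1 \<Delta>"
    using bspec[OF D inHH(1)] by - (rule planar_drawing_cong[OF _ simple(1), of "D E1"], simp_all add: c_def)
  have PB: "planar_drawing V B \<Delta>"
    using bspec[OF D inHH(2)] by - (rule planar_drawing_cong[OF _ BB, of "D B"], auto simp: c_def B_def)
  have col: "\<exists>H\<in>HH. e \<in> H \<and> c e = ecurve (D H) e" if "e \<in> E2" for e
  proof -
    consider "e \<in> E1" | "e \<notin> E1" "e \<in> E3" | "e \<notin> E1" "e \<notin> E3" by blast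
    then show ?thesis
    proof cases
      case 1 then show ?thesis using inHH(1) by (intro bexI[of _ E1]) (simp_all add: c_def)
    next
      case 2 then show ?thesis using inHH(2) by (intro bexI[of _ B]) (simp_all add: c_def B_def)
    next
      case 3
      then have "{e} \<in> HH" using that by (auto simp: HH_def S_def)
      then show ?thesis using 3 by (intro bexI[of _ "{e}"]) (simp_all add: c_def)
    qed
  qed
  have inj: "inj_on p V" using P1 by (simp add: planar_drawing_def is_drawing_def)
  have edge: "\<exists>g. arc g \<and> path_image g = c e \<and> {pathstart g, pathfinish g} = p ` e"
    and vert: "\<forall>v\<in>V. p v \<in> c e \<longrightarrow> v \<in> e"
    and int: "\<exists>H\<in>HH. e \<in> H \<and> edge_interior \<Delta> e = edge_interior (D H) e" if e: "e \<in> E2" for e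
  proof -
    obtain H where H: "H \<in> HH" "e \<in> H" "c e = ecurve (D H) e" using col[OF e] by blast
    have DH: "is_drawing V H (D H)" and pH: "\<forall>v\<in>V. vpos (D H) v = p v"
      using D H(1) by (auto simp: planar_drawing_def)
    have pe: "vpos (D H) ` e = p ` e"
      using pH e simple(2) by (intro image_cong) (auto simp: simple_graph_def)
    show "\<exists>g. arc g \<and> path_image g = c e \<and> {pathstart g, pathfinish g} = p ` e"
      using drawing_arc_ex[OF DH H(2)] pe H(3) by simp
    show "\<forall>v\<in>V. p v \<in> c e \<longrightarrow> v \<in> e"
      using drawing_vertex_on_curve[OF DH H(2)] pH H(3) by simp
    show "\<exists>H\<in>HH. e \<in> H \<and> edge_interior \<Delta> e = edge_interior (D H) e"
      using H pe by (intro bexI[of _ H]) (simp_all add: edge_interior_def)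
  qed
  have "is_drawing V E2 \<Delta>" unfolding is_drawing_def \<Delta> using inj edge vert by blast
  moreover have "\<not> edges_cross \<Delta> e f" if ef: "e \<in> E2" "f \<in> E2" for e f
  proof -
    obtain H where H: "H \<in> HH" "e \<in> H" "edge_interior \<Delta> e = edge_interior (D H) e" using int[OF ef(1)] by blast
    obtain H' where H': "H' \<in> HH" "f \<in> H'" "edge_interior \<Delta> f = edge_interior (D H') f" using int[OF ef(2)] by blast
    show ?thesis using cross[rule_format, OF H(1) H'(1), of e f] H H' ef by (auto simp: edges_cross_def)
  qed
  ultimately have P2: "planar_drawing V E2 \<Delta>" by (simp add: planar_drawing_def)
  \<comment> \<open>\<open>E3\<close> is covered by two classes without inner crossings, so two of
    any three edges lie in one class and do not cross.\<close>
  have E3: "E3 \<subseteq> E1 \<union> B" by (auto simp: B_def)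
  have "is_drawing V (E1 \<union> B) \<Delta>"
    using P1 PB by (simp add: planar_drawing_def is_drawing_def ball_Un)
  then have "is_drawing V E3 \<Delta>" using E3 by (simp add: is_drawing_def subset_iff)
  moreover have "\<not> (edges_cross \<Delta> e f \<and> edges_cross \<Delta> f g \<and> edges_cross \<Delta> e g)"
    if "e \<in> E3" "f \<in> E3" "g \<in> E3" for e f g
  proof -
    have "e \<in> E1 \<or> e \<in> B" "f \<in> E1 \<or> f \<in> B" "g \<in> E1 \<or> g \<in> B" using that E3 by blast+
    moreover have "\<forall>e\<in>E1. \<forall>f\<in>E1. \<not> edges_cross \<Delta> e f" "\<forall>e\<in>B. \<forall>f\<in>B. \<not> edges_cross \<Delta> e f"
      using P1 PB by (simp_all add: planar_drawing_def)
    ultimately show ?thesis by blast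
  qed
  ultimately have P3: "quasiplanar_drawing V E3 \<Delta>" unfolding quasiplanar_drawing_def by blast
  have quasi: "quasiplanar_drawing V E \<Delta>" if "planar_drawing V E \<Delta>" for E
    using that by (auto simp: planar_drawing_def quasiplanar_drawing_def)
  have "is_QuaSEFE V [E1, E2, E3] [\<Delta>, \<Delta>, \<Delta>]"
    using quasi[OF P1] quasi[OF P2] P3
    by (simp add: is_QuaSEFE_def less_Suc_eq numeral_3_eq_3 nth_Cons split: nat.split)
  then show ?thesis using P1 P2 by blast
qed

end
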